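(* For every $\sigma\in(0,1)$ there exist uniformly elliptic matrices $A_1,A_2\in\mathcal{S}^4$ and a nonzero function $u\in C^{2,\sigma}_{\mathrm{loc}}(\mathbb{R}^4)$, homogeneous of degree $2+\sigma$, such that \[\max\bigl\{\mathrm{tr}(A_1D^2u(z)),\,\mathrm{tr}(A_2D^2u(z))\bigr\}=0\qquad\text{for all } z\in\mathbb{R}^4.\] In particular, $u\notin C^{2,\beta}$ at the origin for every $\beta>\sigma$.
   Context: $\mathcal{S}^n$ denotes the space of real symmetric $n\times n$ matrices. A matrix $A\in\mathcal{S}^n$ is called uniformly elliptic if $\lambda\,\mathrm{Id}_n\le A\le\Lambda\,\mathrm{Id}_n$ for some constants $0<\lambda\le\Lambda$. A function $u:\mathbb{R}^n\to\mathbb{R}$ is homogeneous of degree $d$ if $u(tz)=t^du(z)$ for all $t>0$ and $z\in\mathbb{R}^n$. $C^{2,\sigma}_{\mathrm{loc}}$ denotes the $C^2$ functions whose Hessian $D^2u$ is locally $\sigma$-Hölder continuous. "$u\notin C^{2,\beta}$ at the origin" means that there are no constants $C,r>0$ such that $|D^2u(z)-D^2u(0)|\le C|z|^\beta$ for all $|z|<r$. *)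

theory Defs
  imports "HOL-Analysis.Analysis"
begin

definition symmetric_matrix :: "real^'n^'n \<Rightarrow> bool" where
  "symmetric_matrix A \<longleftrightarrow> transpose A = A"

text \<open>The Loewner order: \<open>A \<le> B\<close> as quadratic forms. The componentwise order that the library
  puts on vectors is a different relation.\<close>

definition loewner_le :: "real^'n^'n \<Rightarrow> real^'n^'n \<Rightarrow> bool" where
  "loewner_le A B \<longleftrightarrow> (\<forall>x. x \<bullet> (A *v x) \<le> x \<bullet> (B *v x))"

definition uniformly_elliptic :: "real^'n^'n \<Rightarrow> bool" where
  "uniformly_elliptic A \<longleftrightarrow>
     (\<exists>l L. 0 < l \<and> l \<le> L \<and> loewner_le (l *\<^sub>R mat 1) A \<and> loewner_le A (L *\<^sub>R mat 1))"

definition homogeneous :: "real \<Rightarrow> (real^'n \<Rightarrow> real) \<Rightarrow> bool" where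
  "homogeneous d u \<longleftrightarrow> (\<forall>t>0. \<forall>z. u (t *\<^sub>R z) = t powr d * u z)"

text \<open>\<open>gradient\<close> and \<open>hessian\<close> are total functions; they carry their intended meaning
  only where the derivatives involved exist, which \<open>C2\<close> guarantees everywhere.\<close>

definition gradient :: "(real^'n \<Rightarrow> real) \<Rightarrow> real^'n \<Rightarrow> real^'n" where
  "gradient u z = (\<chi> i. frechet_derivative u (at z) (axis i 1))"

definition hessian :: "(real^'n \<Rightarrow> real) \<Rightarrow> real^'n \<Rightarrow> real^'n^'n" where
  "hessian u z = jacobian (gradient u) (at z)"

definition C2 :: "(real^'n \<Rightarrow> real) \<Rightarrow> bool" where
  "C2 u \<longleftrightarrow> (\<forall>z. u differentiable at z) \<and> (\<forall>z. gradient u differentiable at z) \<and>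
     continuous_on UNIV (hessian u)"

text \<open>The norm of a matrix below is the Euclidean (Frobenius) one; the choice only affects the
  constants \<open>C\<close>.\<close>

definition C2_holder_loc :: "real \<Rightarrow> (real^'n \<Rightarrow> real) \<Rightarrow> bool" where
  "C2_holder_loc \<sigma> u \<longleftrightarrow> C2 u \<and>
     (\<forall>K. compact K \<longrightarrow>
        (\<exists>C. \<forall>x\<in>K. \<forall>y\<in>K. norm (hessian u x - hessian u y) \<le> C * norm (x - y) powr \<sigma>))"

definition C2_holder_at_origin :: "real \<Rightarrow> (real^'n \<Rightarrow> real) \<Rightarrow> bool" where
  "C2_holder_at_origin \<beta> u \<longleftrightarrow>
     (\<exists>C>0. \<exists>r>0. \<forall>z. norm z < r \<longrightarrow> norm (hessian u z - hessian u 0) \<le> C * norm z powr \<beta>)"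

end

theory Submission
  imports Defs
begin

text \<open>
  Write \<open>z = (x, y)\<close> with \<open>x, y \<in> \<real>\<^sup>2\<close> and take \<open>A\<^sub>1 = diag(1, 1, \<nu>, \<nu>)\<close>,
  \<open>A\<^sub>2 = diag(\<nu>, \<nu>, 1, 1)\<close>. In the cone \<open>|y| \<le> |x|\<close> let \<open>u\<close> be the solution of
  \<open>\<Delta>\<^sub>x u + \<nu> \<Delta>\<^sub>y u = 0\<close> that is homogeneous of degree \<open>2 + \<sigma>\<close>, radial in \<open>x\<close> and in \<open>y\<close>, and smooth
  across \<open>y = 0\<close>; extend it by \<open>u(y, x) = u(x, y)\<close>. Then \<open>\<Delta>\<^sub>y u\<close> is homogeneous of degree \<open>\<sigma>\<close> and
  solves the same equation, so it is a negative multiple of \<open>(\<nu>|x|\<^sup>2 + |y|\<^sup>2)\<^bsup>\<sigma>/2\<^esup> P (1 - 2 q)\<close>, where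
  \<open>q = |y|\<^sup>2 / (\<nu>|x|\<^sup>2 + |y|\<^sup>2)\<close> and \<open>P\<close> is the Legendre function of degree \<open>\<sigma>/2\<close>. The plane \<open>x = 0\<close>
  (\<open>q = 1\<close>) has codimension two, so the singularity of this function there is logarithmic, and \<open>P\<close> has a
  zero however small \<open>\<sigma>\<close> is; \<open>\<nu>\<close> is chosen such that the zero set is the cone
  \<open>|y| = |x|\<close>. By Euler's relations, \<open>\<Delta>\<^sub>x u = \<Delta>\<^sub>y u = 0\<close> on the interface
  forces the normal derivative of \<open>u\<close> to vanish there, so the reflected function is
  \<open>C\<^sup>2\<close>, and the sign of \<open>\<Delta>\<^sub>y u\<close> makes the second operator nonpositive.
\<close>

subsection \<open>Lipschitz functions and homogeneous extension\<close>

lemma lipschitz_on_mult_compact: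
  fixes f g :: "'a::metric_space \<Rightarrow> real"
  assumes "compact S" "\<exists>L. L-lipschitz_on S f" "\<exists>L. L-lipschitz_on S g"
  shows "\<exists>L. L-lipschitz_on S (\<lambda>x. f x * g x)"
proof -
  obtain C D where C: "C-lipschitz_on S f" and D: "D-lipschitz_on S g" using assms by blast
  have "bounded (f ` S)" "bounded (g ` S)"
    using assms(1) C D by (auto intro!: compact_imp_bounded compact_continuous_image lipschitz_on_continuous_on)
  then obtain A B where A: "\<forall>x\<in>S. \<bar>f x\<bar> \<le> A" and B: "\<forall>x\<in>S. \<bar>g x\<bar> \<le> B"
    by (auto simp: bounded_iff)
  have C0: "0 \<le> C" "0 \<le> D" using C D by (auto simp: lipschitz_on_nonneg)
  have "(\<bar>A\<bar> * D + \<bar>B\<bar> * C)-lipschitz_on S (\<lambda>x. f x * g x)"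
  proof (rule lipschitz_onI)
    fix x y assume xy: "x \<in> S" "y \<in> S"
    have "f x * g x - f y * g y = f x * (g x - g y) + g y * (f x - f y)"
      by (simp add: algebra_simps)
    also have "\<bar>\<dots>\<bar> \<le> \<bar>f x\<bar> * \<bar>g x - g y\<bar> + \<bar>g y\<bar> * \<bar>f x - f y\<bar>"
      by (metis abs_mult abs_triangle_ineq)
    also have "\<dots> \<le> \<bar>A\<bar> * (D * dist x y) + \<bar>B\<bar> * (C * dist x y)"
    proof (intro add_mono mult_mono)
      show "\<bar>f x\<bar> \<le> \<bar>A\<bar>" "\<bar>g y\<bar> \<le> \<bar>B\<bar>" using A B xy by force+
      show "\<bar>g x - g y\<bar> \<le> D * dist x y" "\<bar>f x - f y\<bar> \<le> C * dist x y"
        using lipschitz_onD[OF D xy] lipschitz_onD[OF C xy] by (auto simp: dist_real_def)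
    qed auto
    finally show "dist (f x * g x) (f y * g y) \<le> (\<bar>A\<bar> * D + \<bar>B\<bar> * C) * dist x y"
      by (simp add: dist_real_def algebra_simps)
  qed (use C0 in auto)
  then show ?thesis by blast
qed

lemma lipschitz_on_ex_add:
  fixes f g :: "'a::metric_space \<Rightarrow> real"
  assumes "\<exists>L. L-lipschitz_on S f" "\<exists>L. L-lipschitz_on S g"
  shows "\<exists>L. L-lipschitz_on S (\<lambda>x. f x + g x)"
  using assms by (blast intro: lipschitz_on_add)

lemma lipschitz_on_ex_sum:
  fixes f :: "'i \<Rightarrow> 'a::metric_space \<Rightarrow> real"
  assumes "finite I" "\<And>i. i \<in> I \<Longrightarrow> \<exists>L. L-lipschitz_on S (f i)"
  shows "\<exists>L. L-lipschitz_on S (\<lambda>x. \<Sum>i\<in>I. f i x)"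
  using assms
proof (induction I rule: finite_induct)
  case empty
  then show ?case by (auto intro: exI[of _ 0] lipschitz_on_constant)
next
  case (insert i I)
  then show ?case by (simp add: lipschitz_on_ex_add)
qed

lemma lipschitz_on_ex_const:
  "\<exists>L. L-lipschitz_on S (\<lambda>x. c)"
  using lipschitz_on_constant by blast

lemma lipschitz_on_ex_component:
  fixes S :: "(real^'n::finite) set"
  shows "\<exists>L. L-lipschitz_on S (\<lambda>z. z $ i)"
  by (intro exI[of _ 1] lipschitz_onI) (auto simp: dist_vec_nth_le)

lemma lipschitz_on_ex_deriv:
  fixes f :: "real \<Rightarrow> real"
  assumes "\<And>t. t \<in> {a..b} \<Longrightarrow> (f has_field_derivative f' t) (at t)" "continuous_on {a..b} f'"
  shows "\<exists>L. L-lipschitz_on {a..b} f"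
proof -
  have "bounded (f' ` {a..b})"
    using assms(2) by (intro compact_imp_bounded compact_continuous_image) auto
  then obtain B where B: "\<forall>t\<in>{a..b}. \<bar>f' t\<bar> \<le> B"
    by (auto simp: bounded_iff)
  have "\<bar>B\<bar>-lipschitz_on {a..b} f"
  proof (rule lipschitz_onI)
    fix x y assume xy: "x \<in> {a..b}" "y \<in> {a..b}"
    have "norm (f x - f y) \<le> \<bar>B\<bar> * norm (x - y)"
      by (rule field_differentiable_bound[of "{a..b}" f f'])
        (use assms(1) B xy in \<open>force intro: has_field_derivative_at_within\<close>)+
    then show "dist (f x) (f y) \<le> \<bar>B\<bar> * dist x y" by (simp add: dist_norm)
  qed simp
  then show ?thesis by blast
qed

lemma lipschitz_on_ex_diff:
  fixes f g :: "'a::metric_space \<Rightarrow> real"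
  assumes "\<exists>L. L-lipschitz_on S f" "\<exists>L. L-lipschitz_on S g"
  shows "\<exists>L. L-lipschitz_on S (\<lambda>x. f x - g x)"
  using assms by (blast intro: lipschitz_on_diff)

lemma lipschitz_on_ex_id:
  "\<exists>L. L-lipschitz_on S (\<lambda>x. x)"
  using lipschitz_on_id by blast

lemma lipschitz_on_ex_compose:
  assumes "\<exists>L. L-lipschitz_on T f" "\<exists>L. L-lipschitz_on S g" "g ` S \<subseteq> T"
  shows "\<exists>L. L-lipschitz_on S (\<lambda>x. f (g x))"
  using assms by (blast intro: lipschitz_on_compose2 lipschitz_on_subset)

text \<open>Subadditivity of \<open>x powr s\<close>: the fractions \<open>b/a\<close> and
  \<open>(a-b)/a\<close> sum to 1 and lie in [0,1], where \<open>x \<le> x powr s\<close>.\<close>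

lemma powr_sub_le_powr_diff:
  fixes a b s :: real
  assumes "0 \<le> b" "b \<le> a" "0 < s" "s \<le> 1"
  shows "a powr s - b powr s \<le> (a - b) powr s"
proof (cases "a = 0")
  case True
  then show ?thesis using assms by simp
next
  case False
  then have a: "0 < a" using assms by simp
  have *: "x \<le> x powr s" if "0 \<le> x" "x \<le> 1" for x :: real
  proof (cases "x = 0")
    case False
    then have "x powr 1 \<le> x powr s" using that assms by (intro powr_mono') auto
    then show ?thesis using that by simp
  qed simp
  have "1 = (b/a) + (a-b)/a" using a by (simp add: field_simps)
  also have "\<dots> \<le> (b/a) powr s + ((a-b)/a) powr s"
    using a assms by (intro add_mono *) auto
  also have "\<dots> = (b powr s + (a-b) powr s) / a powr s"
    using a assms by (simp add: powr_divide add_divide_distrib)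
  finally show ?thesis using a by (simp add: field_simps)
qed

text \<open>Writing \<open>h z = norm z powr s * h (sgn z)\<close> splits a difference into an
  angular part, controlled by the Lipschitz bound on the sphere, and a radial part, controlled by
  subadditivity of \<open>powr s\<close>.\<close>

lemma homogeneous_holder:
  fixes h :: "'a::real_normed_vector \<Rightarrow> real"
  assumes s: "0 < s" "s \<le> 1" and h0: "h 0 = 0"
    and hom: "\<And>t z. 0 < t \<Longrightarrow> h (t *\<^sub>R z) = t powr s * h z"
    and lip: "L-lipschitz_on (sphere 0 1) h"
  shows "\<exists>C\<ge>0. \<forall>x y. \<bar>h x - h y\<bar> \<le> C * norm (x - y) powr s"
proof -
  have "bounded (h ` sphere 0 1)"
  proof -
    have "\<bar>h x\<bar> \<le> L * 2 + \<bar>h w\<bar>" if "x \<in> sphere 0 1" "w \<in> sphere 0 1" for x w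
    proof -
      have "\<bar>h x - h w\<bar> \<le> L * norm (x - w)"
        using lipschitz_on_normD[OF lip that] by simp
      also have "\<dots> \<le> L * 2"
        using that norm_triangle_ineq4[of x w] lipschitz_on_nonneg[OF lip]
        by (intro mult_left_mono) auto
      finally show ?thesis by linarith
    qed
    then have "\<exists>B. \<forall>x\<in>sphere 0 1. \<bar>h x\<bar> \<le> B"
      by meson
    then show ?thesis
      by (auto simp: bounded_iff)
  qed
  then obtain M where M: "\<forall>x\<in>sphere 0 1. \<bar>h x\<bar> \<le> M"
    by (auto simp: bounded_iff)
  define M' where "M' = max M 0"
  have L: "0 \<le> L" using lipschitz_on_nonneg[OF lip] .
  have unit: "h z = norm z powr s * h (sgn z)" for z
    using hom[of "norm z" "sgn z"] h0
    by (cases "z = 0") (auto simp: sgn_div_norm)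
  have M: "\<bar>h (sgn x)\<bar> \<le> M'" for x
    using M[rule_format, of "sgn x"] h0 by (cases "x = 0") (auto simp: M'_def norm_sgn)
  have key: "\<bar>h x - h y\<bar> \<le> (2 * L + M') * norm (x - y) powr s" if xy: "norm y \<le> norm x" for x y
  proof (cases "y = 0")
    case True
    have "\<bar>h x - h y\<bar> = norm x powr s * \<bar>h (sgn x)\<bar>"
      using True h0 unit[of x] by (simp add: abs_mult)
    also have "\<dots> \<le> norm x powr s * (2 * L + M')"
      using M[of x] L by (intro mult_left_mono) auto
    finally show ?thesis using True by (simp add: mult.commute)
  next
    case False
    then have y: "0 < norm y" by simp
    then have x: "0 < norm x" using xy by linarith
    \<comment> \<open>The unit vectors differ by at most \<open>2 * r\<close>, used for
      \<open>r \<le> 1\<close>, where \<open>r \<le> r powr s\<close>, and by at most 2, used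
      otherwise.\<close>
    define r where "r = norm (x - y) / norm x"
    have r0: "0 \<le> r" by (simp add: r_def)
    have "norm (sgn x - sgn y) \<le> 2 * r powr s"
    proof (cases "r \<le> 1")
      case True
      have "sgn x - sgn y = (1 / norm x) *\<^sub>R (x - y) + (1 / norm x - 1 / norm y) *\<^sub>R y"
        by (simp add: sgn_div_norm algebra_simps divide_inverse)
      also have "norm \<dots> \<le> norm ((1 / norm x) *\<^sub>R (x - y)) + norm ((1 / norm x - 1 / norm y) *\<^sub>R y)"
        by (rule norm_triangle_ineq)
      also have "norm ((1 / norm x) *\<^sub>R (x - y)) = r" by (simp add: r_def)
      also have "norm ((1 / norm x - 1 / norm y) *\<^sub>R y) = (norm x - norm y) / norm x"
      proof -
        have "\<bar>1 / norm x - 1 / norm y\<bar> = 1 / norm y - 1 / norm x"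
          using xy x y by (simp add: field_simps)
        then have "norm ((1 / norm x - 1 / norm y) *\<^sub>R y) = (1 / norm y - 1 / norm x) * norm y"
          by (simp only: norm_scaleR real_norm_def)
        also have "\<dots> = (norm x - norm y) / norm x"
          using x y by (simp add: field_simps)
        finally show ?thesis .
      qed
      also have "(norm x - norm y) / norm x \<le> r"
        unfolding r_def using norm_triangle_ineq2[of x y] x by (intro divide_right_mono) auto
      finally have "norm (sgn x - sgn y) \<le> 2 * r" by simp
      moreover have "r \<le> r powr s"
      proof (cases "r = 0")
        case False
        then have "r powr 1 \<le> r powr s" using True r0 s by (intro powr_mono') auto
        then show ?thesis using r0 by simp
      qed simp
      ultimately show ?thesis by simp
    next
      case r: False
      have "norm (sgn x - sgn y) \<le> 2"
        using norm_triangle_ineq4[of "sgn x" "sgn y"] x y by (simp add: norm_sgn)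
      moreover have "1 \<le> r powr s" using r s by (intro ge_one_powr_ge_zero) auto
      ultimately show ?thesis by linarith
    qed
    then have "\<bar>h (sgn x) - h (sgn y)\<bar> \<le> L * (2 * r powr s)"
      using lipschitz_on_normD[OF lip, of "sgn x" "sgn y"] x y L
      by (smt (verit) mult_left_mono mem_sphere_0 norm_sgn norm_zero real_norm_def)
    then have a: "norm x powr s * \<bar>h (sgn x) - h (sgn y)\<bar> \<le> 2 * L * norm (x - y) powr s"
    proof -
      assume a: "\<bar>h (sgn x) - h (sgn y)\<bar> \<le> L * (2 * r powr s)"
      have "norm x powr s * \<bar>h (sgn x) - h (sgn y)\<bar> \<le> norm x powr s * (L * (2 * r powr s))"
        using a by (intro mult_left_mono) auto
      also have "\<dots> = 2 * L * norm (x - y) powr s"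
        using x by (simp add: r_def powr_divide)
      finally show ?thesis .
    qed
    have "norm x powr s - norm y powr s \<le> (norm x - norm y) powr s"
      using xy s by (intro powr_sub_le_powr_diff) auto
    also have "\<dots> \<le> norm (x - y) powr s"
      using xy s norm_triangle_ineq2[of x y] by (intro powr_mono2) auto
    finally have b: "(norm x powr s - norm y powr s) * \<bar>h (sgn y)\<bar> \<le> norm (x - y) powr s * M'"
      using M[of y] by (intro mult_mono) auto
    have "h x - h y = norm x powr s * (h (sgn x) - h (sgn y)) + (norm x powr s - norm y powr s) * h (sgn y)"
      using unit[of x] unit[of y] by (simp add: algebra_simps)
    also have "\<bar>\<dots>\<bar> \<le> norm x powr s * \<bar>h (sgn x) - h (sgn y)\<bar> + (norm x powr s - norm y powr s) * \<bar>h (sgn y)\<bar>"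
    proof -
      have "norm y powr s \<le> norm x powr s" using xy s by (intro powr_mono2) auto
      then show ?thesis by (intro order_trans[OF abs_triangle_ineq]) (auto simp: abs_mult)
    qed
    finally show ?thesis using a b by (simp add: algebra_simps)
  qed
  have "\<bar>h x - h y\<bar> \<le> (2 * L + M') * norm (x - y) powr s" for x y
  proof (cases "norm y \<le> norm x")
    case False
    then show ?thesis using key[of x y] by (simp add: abs_minus_commute norm_minus_commute)
  qed (use key in auto)
  moreover have "0 \<le> 2 * L + M'" using L by (simp add: M'_def)
  ultimately show ?thesis by blast
qed

lemma has_derivative_zero_if_superlinear:
  fixes f :: "'a::real_normed_vector \<Rightarrow> 'b::real_normed_vector"
  assumes "f 0 = 0" "1 < k" "\<And>z. norm (f z) \<le> C * norm z powr k"
  shows "(f has_derivative (\<lambda>h. 0)) (at 0)"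
proof -
  have "((\<lambda>h::'a. norm h powr (k - 1)) \<longlongrightarrow> 0 powr (k - 1)) (at 0)"
    using assms(2) by (intro tendsto_powr' tendsto_norm_zero tendsto_ident_at tendsto_const) auto
  then have "((\<lambda>h::'a. norm h powr (k - 1)) \<longlongrightarrow> 0) (at 0)"
    by simp
  then have upper: "((\<lambda>h::'a. C * norm h powr (k - 1)) \<longlongrightarrow> 0) (at 0)"
    by (rule tendsto_mult_right_zero)
  have le: "norm (f h) / norm h \<le> C * norm h powr (k - 1)" for h
  proof (cases "h = 0")
    case False
    then have "norm (f h) / norm h \<le> C * norm h powr k / norm h"
      using assms(3)[of h] by (intro divide_right_mono) auto
    then show ?thesis using False by (simp add: powr_diff)
  qed simp
  have "((\<lambda>h. norm (f h) / norm h) \<longlongrightarrow> 0) (at 0)"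
    by (rule tendsto_sandwich[OF always_eventually always_eventually tendsto_const upper]) (use le in auto)
  then show ?thesis
    using assms(1) unfolding has_derivative_at by simp
qed

subsection \<open>Functions of the norm and of a ratio of quadratic forms\<close>

definition weighted_form :: "('n::finite \<Rightarrow> real) \<Rightarrow> real^'n \<Rightarrow> real" where
  "weighted_form \<kappa> z = (\<Sum>i\<in>UNIV. \<kappa> i * (z $ i)\<^sup>2)"

definition weight_ratio :: "('n::finite \<Rightarrow> real) \<Rightarrow> real^'n \<Rightarrow> real" where
  "weight_ratio \<kappa> z = weighted_form \<kappa> z / (z \<bullet> z)"

text \<open>Since \<open>0 / 0 = 0\<close> and \<open>0 powr k = 0\<close>, this vanishes at the origin for every exponent \<open>k\<close>.\<close>

definition hom_ext :: "('n::finite \<Rightarrow> real) \<Rightarrow> real \<Rightarrow> (real \<Rightarrow> real) \<Rightarrow> real^'n \<Rightarrow> real" where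
  "hom_ext \<kappa> k Q z = (z \<bullet> z) powr k * Q (weight_ratio \<kappa> z)"

text \<open>With \<open>c = \<kappa> j\<close>, the j-th partial derivative of
  \<open>hom_ext \<kappa> k Q\<close> is \<open>2 * z $ j\<close> times the extension of this
  profile with exponent \<open>k - 1\<close>. Up to coordinate factors, the class of extensions is
  closed under differentiation.\<close>

definition hom_partial :: "real \<Rightarrow> real \<Rightarrow> (real \<Rightarrow> real) \<Rightarrow> (real \<Rightarrow> real) \<Rightarrow> real \<Rightarrow> real" where
  "hom_partial k c Q Q' t = k * Q t + (c - t) * Q' t"

lemma weight_ratio_bounds:
  fixes z :: "real^'n::finite"
  assumes "\<And>i. 0 \<le> \<kappa> i \<and> \<kappa> i \<le> 1"
  shows "weight_ratio \<kappa> z \<in> {0..1}"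
proof -
  have "z \<bullet> z = (\<Sum>i\<in>UNIV. (z $ i)\<^sup>2)"
    by (simp add: inner_vec_def power2_eq_square)
  moreover have "weighted_form \<kappa> z \<le> (\<Sum>i\<in>UNIV. (z $ i)\<^sup>2)"
    unfolding weighted_form_def
    using assms by (intro sum_mono) (simp add: mult_left_le_one_le)
  moreover have "0 \<le> weighted_form \<kappa> z"
    unfolding weighted_form_def using assms by (intro sum_nonneg) simp
  ultimately show ?thesis
    unfolding weight_ratio_def by (auto simp: divide_le_eq_1)
qed

lemma hom_ext_scale:
  assumes "0 < t"
  shows "hom_ext \<kappa> k Q (t *\<^sub>R z) = t powr (2 * k) * hom_ext \<kappa> k Q z"
proof -
  have "weighted_form \<kappa> (t *\<^sub>R z) = t\<^sup>2 * weighted_form \<kappa> z"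
    unfolding weighted_form_def sum_distrib_left
    by (intro sum.cong) (auto simp: power_mult_distrib)
  then have "weight_ratio \<kappa> (t *\<^sub>R z) = weight_ratio \<kappa> z"
    using assms unfolding weight_ratio_def by (simp add: power2_eq_square)
  moreover have "(t *\<^sub>R z \<bullet> t *\<^sub>R z) powr k = t powr (2 * k) * (z \<bullet> z) powr k"
  proof -
    have "(t *\<^sub>R z \<bullet> t *\<^sub>R z) = t powr 2 * (z \<bullet> z)"
      using assms by (simp add: power2_eq_square)
    then show ?thesis
      using assms by (simp only: powr_mult powr_powr)
  qed
  ultimately show ?thesis
    unfolding hom_ext_def by simp
qed

text \<open>Chain rule: the j-th partial derivative of the ratio \<tau> is
  \<open>2 * (\<kappa> j - \<tau>) * z $ j / (z \<bullet> z)\<close>.\<close>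

lemma hom_ext_has_derivative:
  fixes z :: "real^'n::finite"
  assumes z: "z \<noteq> 0" and Q: "(Q has_field_derivative Q' (weight_ratio \<kappa> z)) (at (weight_ratio \<kappa> z))"
  shows "(hom_ext \<kappa> k Q has_derivative
     (\<lambda>h. \<Sum>j\<in>UNIV. 2 * z $ j * h $ j * hom_ext \<kappa> (k - 1) (hom_partial k (\<kappa> j) Q Q') z)) (at z)"
proof -
  let ?\<tau> = "weight_ratio \<kappa> z"
  have pos: "0 < z \<bullet> z" using z by simp
  have W: "(weighted_form \<kappa> has_derivative (\<lambda>h. \<Sum>j\<in>UNIV. 2 * \<kappa> j * z $ j * h $ j)) (at z)"
    unfolding weighted_form_def
    by (auto intro!: derivative_eq_intros bounded_linear_imp_has_derivative[OF bounded_linear_vec_nth] sum.cong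
        simp: algebra_simps power2_eq_square fun_eq_iff)
  have N: "((\<lambda>z. z \<bullet> z) has_derivative (\<lambda>h. \<Sum>j\<in>UNIV. 2 * z $ j * h $ j)) (at z)"
  proof -
    have "((\<lambda>z. z \<bullet> z) has_derivative (\<lambda>h. z \<bullet> h + h \<bullet> z)) (at z)"
      by (rule has_derivative_inner[OF has_derivative_ident has_derivative_ident])
    moreover have "z \<bullet> h + h \<bullet> z = (\<Sum>j\<in>UNIV. 2 * z $ j * h $ j)" for h
      unfolding inner_vec_def sum.distrib[symmetric] by (intro sum.cong) auto
    ultimately show ?thesis by simp
  qed
  have R: "(weight_ratio \<kappa> has_derivative
      (\<lambda>h. \<Sum>j\<in>UNIV. 2 * (\<kappa> j - ?\<tau>) * z $ j * h $ j / (z \<bullet> z))) (at z)"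
  proof -
    have "((\<lambda>z. weighted_form \<kappa> z / (z \<bullet> z)) has_derivative
      (\<lambda>h. ((\<Sum>j\<in>UNIV. 2 * \<kappa> j * z $ j * h $ j) * (z \<bullet> z) - weighted_form \<kappa> z * (\<Sum>j\<in>UNIV. 2 * z $ j * h $ j)) / ((z \<bullet> z) * (z \<bullet> z)))) (at z)"
      using has_derivative_divide'[OF W N] pos by simp
    moreover have "((\<Sum>j\<in>UNIV. 2 * \<kappa> j * z $ j * h $ j) * (z \<bullet> z) - weighted_form \<kappa> z * (\<Sum>j\<in>UNIV. 2 * z $ j * h $ j)) / ((z \<bullet> z) * (z \<bullet> z))
      = (\<Sum>j\<in>UNIV. 2 * (\<kappa> j - ?\<tau>) * z $ j * h $ j / (z \<bullet> z))" for h
    proof -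
      have "weighted_form \<kappa> z = ?\<tau> * (z \<bullet> z)"
        using pos by (simp add: weight_ratio_def)
      then have "((\<Sum>j\<in>UNIV. 2 * \<kappa> j * z $ j * h $ j) * (z \<bullet> z) - weighted_form \<kappa> z * (\<Sum>j\<in>UNIV. 2 * z $ j * h $ j)) / ((z \<bullet> z) * (z \<bullet> z))
        = ((\<Sum>j\<in>UNIV. 2 * \<kappa> j * z $ j * h $ j) - ?\<tau> * (\<Sum>j\<in>UNIV. 2 * z $ j * h $ j)) / (z \<bullet> z)"
        using pos by (simp add: field_simps)
      also have "\<dots> = (\<Sum>j\<in>UNIV. 2 * (\<kappa> j - ?\<tau>) * z $ j * h $ j / (z \<bullet> z))"
        unfolding sum_distrib_left sum_subtractf[symmetric] sum_divide_distrib
        by (intro sum.cong) (auto simp: algebra_simps)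
      finally show ?thesis .
    qed
    ultimately show ?thesis
      unfolding weight_ratio_def by simp
  qed
  have Qd: "((\<lambda>z. Q (weight_ratio \<kappa> z)) has_derivative
      (\<lambda>h. Q' ?\<tau> * (\<Sum>j\<in>UNIV. 2 * (\<kappa> j - ?\<tau>) * z $ j * h $ j / (z \<bullet> z)))) (at z)"
    using has_derivative_compose[OF R Q[unfolded has_field_derivative_def]] by simp
  have "((\<lambda>x. x powr k) has_real_derivative k * (z \<bullet> z) powr (k - 1)) (at (z \<bullet> z))"
    by (rule has_real_derivative_powr[OF pos])
  then have Pd: "((\<lambda>z. (z \<bullet> z) powr k) has_derivative
      (\<lambda>h. k * (z \<bullet> z) powr (k - 1) * (\<Sum>j\<in>UNIV. 2 * z $ j * h $ j))) (at z)"
    using has_derivative_compose[OF N, of "\<lambda>x. x powr k"] by (simp add: has_field_derivative_def)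
  have "(z \<bullet> z) powr k = (z \<bullet> z) powr (k - 1) * (z \<bullet> z)"
    using pos by (simp add: powr_mult_base powr_diff)
  then have "(\<lambda>h. (z \<bullet> z) powr k * (Q' ?\<tau> * (\<Sum>j\<in>UNIV. 2 * (\<kappa> j - ?\<tau>) * z $ j * h $ j / (z \<bullet> z))) +
      k * (z \<bullet> z) powr (k - 1) * (\<Sum>j\<in>UNIV. 2 * z $ j * h $ j) * Q ?\<tau>)
    = (\<lambda>h. \<Sum>j\<in>UNIV. 2 * z $ j * h $ j * hom_ext \<kappa> (k - 1) (hom_partial k (\<kappa> j) Q Q') z)"
    unfolding sum_distrib_left sum_distrib_right sum.distrib[symmetric] hom_ext_def hom_partial_def
    using pos by (intro ext sum.cong) (auto simp: field_simps)
  then show ?thesis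
    using has_derivative_mult[OF Pd Qd] unfolding hom_ext_def by simp
qed

lemma inner_powr_eq_norm_powr: "(z \<bullet> z) powr k = norm z powr (2 * k)"
  for z :: "'a::real_inner"
  by (simp add: power2_norm_eq_inner[symmetric] powr_powr flip: powr_numeral)

text \<open>\<open>e\<close> is half the degree of homogeneity. The Hessian has degree
  \<open>2 * (e - 1)\<close>, and the bounds on \<open>e\<close> put this Holder exponent in (0,1].
  A Lipschitz second derivative leaves room for a jump of the third one at an interface.\<close>

locale homogeneous_profile =
  fixes \<kappa> :: "'n::finite \<Rightarrow> real" and e :: real and \<Phi> \<Phi>' \<Phi>'' :: "real \<Rightarrow> real"
  assumes \<kappa>: "0 \<le> \<kappa> i \<and> \<kappa> i \<le> 1"
    and e: "1 < e" "e \<le> 3 / 2"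
    and \<Phi>: "t \<in> {0..1} \<Longrightarrow> (\<Phi> has_field_derivative \<Phi>' t) (at t)"
    and \<Phi>': "t \<in> {0..1} \<Longrightarrow> (\<Phi>' has_field_derivative \<Phi>'' t) (at t)"
    and \<Phi>'': "\<exists>L. L-lipschitz_on {0..1} \<Phi>''"
begin

definition grad_profile :: "'n \<Rightarrow> real \<Rightarrow> real" where
  "grad_profile i = hom_partial e (\<kappa> i) \<Phi> \<Phi>'"

definition grad_profile' :: "'n \<Rightarrow> real \<Rightarrow> real" where
  "grad_profile' i t = (e - 1) * \<Phi>' t + (\<kappa> i - t) * \<Phi>'' t"

definition hess_profile :: "'n \<Rightarrow> 'n \<Rightarrow> real \<Rightarrow> real" where
  "hess_profile i j = hom_partial (e - 1) (\<kappa> j) (grad_profile i) (grad_profile' i)"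

definition grad_field :: "real^'n \<Rightarrow> real^'n" where
  "grad_field z = (\<chi> i. 2 * z $ i * hom_ext \<kappa> (e - 1) (grad_profile i) z)"

text \<open>The first term differentiates the coordinate factor of \<open>grad_field\<close>, the
  second its \<open>hom_ext\<close> factor. At the origin every entry is 0, since
  \<open>hom_ext\<close> vanishes there.\<close>

definition hess_field :: "real^'n \<Rightarrow> real^'n^'n" where
  "hess_field z = (\<chi> i j. (if i = j then 2 * hom_ext \<kappa> (e - 1) (grad_profile i) z else 0) +
     4 * z $ i * z $ j * hom_ext \<kappa> (e - 2) (hess_profile i j) z)"

abbreviation u :: "real^'n \<Rightarrow> real" where
  "u \<equiv> hom_ext \<kappa> e \<Phi>"

section \<open>Gradient and Hessian of the homogeneous extension\<close>

lemma ratio: "weight_ratio \<kappa> z \<in> {0..1}"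
  using weight_ratio_bounds \<kappa> by blast

lemma grad_profile_deriv:
  "t \<in> {0..1} \<Longrightarrow> (grad_profile i has_field_derivative grad_profile' i t) (at t)"
  unfolding grad_profile_def hom_partial_def grad_profile'_def
  by (auto intro!: derivative_eq_intros \<Phi> \<Phi>' simp: algebra_simps)

lemma lipschitz_profiles:
  "\<exists>L. L-lipschitz_on {0..1} \<Phi>" "\<exists>L. L-lipschitz_on {0..1} \<Phi>'"
proof -
  have "continuous_on {0..1} \<Phi>''" using \<Phi>'' lipschitz_on_continuous_on by blast
  then show *: "\<exists>L. L-lipschitz_on {0..1} \<Phi>'"
    using lipschitz_on_ex_deriv[of 0 1 \<Phi>' \<Phi>''] \<Phi>' by blast
  then have "continuous_on {0..1} \<Phi>'" using lipschitz_on_continuous_on by blast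
  then show "\<exists>L. L-lipschitz_on {0..1} \<Phi>"
    using lipschitz_on_ex_deriv[of 0 1 \<Phi> \<Phi>'] \<Phi> by blast
qed

lemma lipschitz_grad_profile: "\<exists>L. L-lipschitz_on {0..1} (grad_profile i)"
  unfolding grad_profile_def hom_partial_def diff_conv_add_uminus
  by (intro lipschitz_on_ex_add lipschitz_on_mult_compact lipschitz_on_ex_const lipschitz_profiles
      exI[of _ 1] lipschitz_on_minus[OF lipschitz_on_id] compact_Icc)

lemma lipschitz_hess_profile: "\<exists>L. L-lipschitz_on {0..1} (hess_profile i j)"
proof -
  have *: "\<exists>L. L-lipschitz_on {0..1} (\<lambda>t. c - t)" for c :: real
    unfolding diff_conv_add_uminus
    by (intro lipschitz_on_ex_add lipschitz_on_ex_const exI[of _ 1] lipschitz_on_minus[OF lipschitz_on_id])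
  show ?thesis
    unfolding hess_profile_def hom_partial_def grad_profile'_def
    by (intro lipschitz_on_ex_add lipschitz_on_mult_compact lipschitz_on_ex_const lipschitz_profiles
        lipschitz_grad_profile \<Phi>'' * compact_Icc)
qed

lemma hom_ext_bound:
  assumes "\<exists>L. L-lipschitz_on {0..1} Q"
  shows "\<exists>C\<ge>0. \<forall>z::real^'n. \<bar>hom_ext \<kappa> k Q z\<bar> \<le> C * norm z powr (2 * k)"
proof -
  have "bounded (Q ` {0..1})"
    using assms by (auto intro!: compact_imp_bounded compact_continuous_image lipschitz_on_continuous_on)
  then obtain B where B: "\<forall>t\<in>{0..1}. \<bar>Q t\<bar> \<le> B" by (auto simp: bounded_iff)
  have "\<bar>hom_ext \<kappa> k Q z\<bar> \<le> \<bar>B\<bar> * norm z powr (2 * k)" for z :: "real^'n"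
  proof -
    have "\<bar>hom_ext \<kappa> k Q z\<bar> = \<bar>Q (weight_ratio \<kappa> z)\<bar> * norm z powr (2 * k)"
      by (simp add: hom_ext_def abs_mult inner_powr_eq_norm_powr)
    also have "\<dots> \<le> \<bar>B\<bar> * norm z powr (2 * k)"
      using B ratio[of z] by (intro mult_right_mono) force+
    finally show ?thesis .
  qed
  then show ?thesis by (intro exI[of _ "\<bar>B\<bar>"]) auto
qed

lemma u_has_derivative: "(u has_derivative (\<lambda>h. grad_field z \<bullet> h)) (at z)"
proof (cases "z = 0")
  case True
  obtain C where "\<And>z::real^'n. \<bar>u z\<bar> \<le> C * norm z powr (2 * e)"
    using hom_ext_bound[OF lipschitz_profiles(1)] by blast
  then have "(u has_derivative (\<lambda>h. 0)) (at 0)"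
    by (intro has_derivative_zero_if_superlinear[where k = "2 * e" and C = C])
      (use e in \<open>auto simp: hom_ext_def\<close>)
  then show ?thesis using True by (simp add: grad_field_def inner_vec_def)
next
  case False
  then show ?thesis
    using hom_ext_has_derivative[where Q = \<Phi> and Q' = \<Phi>' and k = e, OF False] \<Phi> ratio[of z]
    by (simp add: grad_field_def inner_vec_def grad_profile_def ac_simps)
qed

lemma gradient_u: "gradient u = grad_field"
proof
  fix z
  have "frechet_derivative u (at z) = (\<lambda>h. grad_field z \<bullet> h)"
    using frechet_derivative_at[OF u_has_derivative] by simp
  then show "gradient u z = grad_field z"
    by (simp add: gradient_def vec_eq_iff inner_axis)
qed

lemma grad_field_has_derivative:
  "(grad_field has_derivative (\<lambda>h. hess_field z *v h)) (at z)"
proof (subst has_derivative_componentwise_within, intro ballI)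
  fix b :: "real^'n" assume "b \<in> Basis"
  then obtain i where b: "b = axis i 1" by (auto simp: Basis_vec_def)
  have "((\<lambda>z. grad_field z $ i) has_derivative (\<lambda>h. (hess_field z *v h) $ i)) (at z)"
  proof (cases "z = 0")
    case True
    \<comment> \<open>A component of the gradient has degree \<open>2 * e - 1 > 1\<close>: one from
      the coordinate factor and \<open>2 * (e - 1)\<close> from \<open>hom_ext\<close>. Hence its
      derivative at the origin is zero.\<close>
    obtain C where C: "\<And>z::real^'n. \<bar>hom_ext \<kappa> (e - 1) (grad_profile i) z\<bar> \<le> C * norm z powr (2 * (e - 1))"
      using hom_ext_bound[OF lipschitz_grad_profile] by blast
    have "((\<lambda>z. grad_field z $ i) has_derivative (\<lambda>h. 0)) (at 0)"
    proof (rule has_derivative_zero_if_superlinear)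
      show "norm (grad_field w $ i) \<le> 2 * C * norm w powr (2 * e - 1)" for w
      proof -
        have "norm (grad_field w $ i) \<le> 2 * norm w * (C * norm w powr (2 * (e - 1)))"
          unfolding grad_field_def using C[of w] component_le_norm_cart[of w i]
          by (simp add: abs_mult) (intro mult_mono, auto)
        also have "\<dots> = 2 * C * norm w powr (2 * e - 1)"
          by (cases "w = 0") (auto simp: powr_mult_base)
        finally show ?thesis .
      qed
    qed (use e in \<open>auto simp: grad_field_def\<close>)
    moreover have "hess_field 0 = 0"
      by (simp add: hess_field_def hom_ext_def vec_eq_iff)
    ultimately show ?thesis using True by simp
  next
    case False
    have "((\<lambda>z. 2 * z $ i * hom_ext \<kappa> (e - 1) (grad_profile i) z) has_derivative
      (\<lambda>h. 2 * z $ i * (\<Sum>j\<in>UNIV. 2 * z $ j * h $ j * hom_ext \<kappa> (e - 1 - 1) (hom_partial (e - 1) (\<kappa> j) (grad_profile i) (grad_profile' i)) z)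
        + 2 * h $ i * hom_ext \<kappa> (e - 1) (grad_profile i) z)) (at z)"
      by (intro has_derivative_mult has_derivative_mult_right bounded_linear_imp_has_derivative
          bounded_linear_vec_nth hom_ext_has_derivative False grad_profile_deriv ratio)
    moreover have "2 * z $ i * (\<Sum>j\<in>UNIV. 2 * z $ j * h $ j * hom_ext \<kappa> (e - 1 - 1) (hom_partial (e - 1) (\<kappa> j) (grad_profile i) (grad_profile' i)) z)
        + 2 * h $ i * hom_ext \<kappa> (e - 1) (grad_profile i) z = (hess_field z *v h) $ i" for h
    proof -
      have "(hess_field z *v h) $ i = (\<Sum>j\<in>UNIV. (if i = j then 2 * h $ j * hom_ext \<kappa> (e - 1) (grad_profile i) z else 0) +
          2 * z $ i * (2 * z $ j * h $ j * hom_ext \<kappa> (e - 1 - 1) (hom_partial (e - 1) (\<kappa> j) (grad_profile i) (grad_profile' i)) z))"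
        unfolding hess_field_def matrix_vector_mult_def hess_profile_def
        by (auto intro!: sum.cong simp: algebra_simps)
      then show ?thesis
        by (simp add: sum.distrib sum_distrib_left)
    qed
    ultimately show ?thesis by (simp add: grad_field_def)
  qed
  then show "((\<lambda>z. grad_field z \<bullet> b) has_derivative (\<lambda>h. (hess_field z *v h) \<bullet> b)) (at z)"
    by (simp add: b inner_axis)
qed

lemma hessian_u: "hessian u = hess_field"
proof
  fix z
  have "frechet_derivative grad_field (at z) = (\<lambda>h. hess_field z *v h)"
    using frechet_derivative_at[OF grad_field_has_derivative] by simp
  then show "hessian u z = hess_field z"
    by (simp add: hessian_def gradient_u jacobian_def)
qed

section \<open>Holder continuity of the Hessian and its sharpness at the origin\<close>

lemma hess_field_entry_scale:
  assumes "0 < t"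
  shows "hess_field (t *\<^sub>R z) $ i $ j = t powr (2 * (e - 1)) * hess_field z $ i $ j"
proof -
  \<comment> \<open>The two coordinate factors in the second term of an entry raise the degree
    \<open>2 * (e - 2)\<close> to \<open>2 * (e - 1)\<close>.\<close>
  have "t * (t * t powr (2 * (e - 2))) = t powr (2 * (e - 1))"
    using assms by (simp add: powr_mult_base)
  then show ?thesis
    using assms by (simp add: hess_field_def hom_ext_scale algebra_simps)
qed

text \<open>On the unit sphere \<open>weight_ratio\<close> is the polynomial
  \<open>weighted_form\<close>, so an entry is composed of coordinates and Lipschitz profiles by
  sums and products.\<close>

lemma lipschitz_hess_field: "\<exists>L. L-lipschitz_on (sphere 0 1) (\<lambda>z. hess_field z $ i $ j)"
proof -
  have sub: "weighted_form \<kappa> ` sphere 0 1 \<subseteq> {0..1}"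
  proof clarify
    fix z :: "real^'n" assume "z \<in> sphere 0 1"
    then have "z \<bullet> z = 1" by (simp flip: power2_norm_eq_inner)
    then show "weighted_form \<kappa> z \<in> {0..1}"
      using ratio[of z] by (simp add: weight_ratio_def)
  qed
  have "\<exists>L. L-lipschitz_on (sphere 0 1) (weighted_form \<kappa>)"
    unfolding weighted_form_def power2_eq_square
    by (intro lipschitz_on_ex_sum lipschitz_on_mult_compact lipschitz_on_ex_const
        lipschitz_on_ex_component finite compact_sphere)
  then have comp: "\<exists>L. L-lipschitz_on (sphere 0 1) (\<lambda>z. Q (weighted_form \<kappa> z))"
    if "\<exists>L. L-lipschitz_on {0..1} Q" for Q :: "real \<Rightarrow> real"
    using that sub by (blast intro: lipschitz_on_compose2 lipschitz_on_subset)
  have "\<exists>L. L-lipschitz_on (sphere 0 1) (\<lambda>z.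
      (if i = j then 2 else 0) * grad_profile i (weighted_form \<kappa> z) +
      4 * z $ i * z $ j * hess_profile i j (weighted_form \<kappa> z))"
    by (intro lipschitz_on_ex_add lipschitz_on_mult_compact lipschitz_on_ex_const comp
        lipschitz_grad_profile lipschitz_hess_profile lipschitz_on_ex_component compact_sphere)
  then obtain L where L: "L-lipschitz_on (sphere 0 1) (\<lambda>z.
      (if i = j then 2 else 0) * grad_profile i (weighted_form \<kappa> z) +
      4 * z $ i * z $ j * hess_profile i j (weighted_form \<kappa> z))" ..
  have "hess_field z $ i $ j = (if i = j then 2 else 0) * grad_profile i (weighted_form \<kappa> z) +
      4 * z $ i * z $ j * hess_profile i j (weighted_form \<kappa> z)" if "z \<in> sphere 0 1" for z
  proof -
    have "z \<bullet> z = 1" using that by (simp flip: power2_norm_eq_inner)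
    then show ?thesis by (simp add: hess_field_def hom_ext_def weight_ratio_def)
  qed
  then have "L-lipschitz_on (sphere 0 1) (\<lambda>z. hess_field z $ i $ j)"
    using lipschitz_on_transform[OF L] by metis
  then show ?thesis ..
qed

lemma hess_field_holder:
  "\<exists>C\<ge>0. \<forall>x y. norm (hess_field x - hess_field y) \<le> C * norm (x - y) powr (2 * (e - 1))"
proof -
  have "\<exists>C\<ge>0. \<forall>x y. \<bar>hess_field x $ i $ j - hess_field y $ i $ j\<bar> \<le> C * norm (x - y) powr (2 * (e - 1))" for i j
  proof -
    obtain L where "L-lipschitz_on (sphere 0 1) (\<lambda>z. hess_field z $ i $ j)"
      using lipschitz_hess_field by blast
    then show ?thesis
      by (intro homogeneous_holder hess_field_entry_scale) (use e in \<open>auto simp: hess_field_def hom_ext_def\<close>)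
  qed
  then obtain C where C0: "\<And>i j. 0 \<le> C i j"
    and C: "\<And>i j x y. \<bar>hess_field x $ i $ j - hess_field y $ i $ j\<bar> \<le> C i j * norm (x - y) powr (2 * (e - 1))"
    by metis
  have "norm (hess_field x - hess_field y) \<le> (\<Sum>i\<in>UNIV. \<Sum>j\<in>UNIV. C i j) * norm (x - y) powr (2 * (e - 1))" for x y
  proof -
    have "norm (hess_field x - hess_field y) \<le> (\<Sum>i\<in>UNIV. norm ((hess_field x - hess_field y) $ i))"
      unfolding norm_vec_def by (rule L2_set_le_sum) auto
    also have "\<dots> \<le> (\<Sum>i\<in>UNIV. \<Sum>j\<in>UNIV. \<bar>(hess_field x - hess_field y) $ i $ j\<bar>)"
      by (intro sum_mono norm_le_l1_cart)
    also have "\<dots> \<le> (\<Sum>i\<in>UNIV. \<Sum>j\<in>UNIV. C i j * norm (x - y) powr (2 * (e - 1)))"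
      by (intro sum_mono) (use C in auto)
    finally show ?thesis by (simp add: sum_distrib_right)
  qed
  then show ?thesis
    using C0 by (intro exI[of _ "\<Sum>i\<in>UNIV. \<Sum>j\<in>UNIV. C i j"]) (auto intro!: sum_nonneg)
qed

lemma C2_holder_loc_u: "C2_holder_loc (2 * (e - 1)) u"
proof -
  obtain C where "0 \<le> C" and C: "\<And>x y. norm (hess_field x - hess_field y) \<le> C * norm (x - y) powr (2 * (e - 1))"
    using hess_field_holder by blast
  have "isCont hess_field z" for z
  proof -
    have "((\<lambda>x. norm (x - z) powr (2 * (e - 1))) \<longlongrightarrow> 0 powr (2 * (e - 1))) (at z)"
      using e by (intro tendsto_powr' tendsto_norm_zero tendsto_const LIM_zero tendsto_ident_at) auto
    then have "((\<lambda>x. norm (x - z) powr (2 * (e - 1))) \<longlongrightarrow> 0) (at z)"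
      by simp
    then have "((\<lambda>x. C * norm (x - z) powr (2 * (e - 1))) \<longlongrightarrow> 0) (at z)"
      by (rule tendsto_mult_right_zero)
    then have "((\<lambda>x. hess_field x - hess_field z) \<longlongrightarrow> 0) (at z)"
      by (rule Lim_null_comparison[OF always_eventually, rotated]) (use C in auto)
    then show ?thesis
      unfolding isCont_def by (rule LIM_zero_cancel)
  qed
  then have "continuous_on UNIV hess_field"
    by (simp add: continuous_at_imp_continuous_on)
  then show ?thesis
    unfolding C2_holder_loc_def C2_def gradient_u hessian_u
    using u_has_derivative grad_field_has_derivative C
    unfolding differentiable_def by blast
qed

lemma homogeneous_u: "homogeneous (2 * e) u"
  by (simp add: homogeneous_def hom_ext_scale)

text \<open>Along the ray through \<open>z\<close> the Hessian scales like
  \<open>t powr (2 * (e - 1))\<close>; a bound by a multiple of \<open>t powr \<beta>\<close> with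
  larger \<beta> forces it to vanish at \<open>z\<close> as \<open>t\<close> tends to 0.\<close>

lemma not_C2_holder_at_origin_u:
  assumes "hess_field z \<noteq> 0" "2 * (e - 1) < \<beta>"
  shows "\<not> C2_holder_at_origin \<beta> u"
proof
  assume "C2_holder_at_origin \<beta> u"
  then obtain C r where Cr: "0 < C" "0 < r"
    and C: "\<And>z. norm z < r \<Longrightarrow> norm (hess_field z - hess_field 0) \<le> C * norm z powr \<beta>"
    unfolding C2_holder_at_origin_def hessian_u by blast
  have h0: "hess_field 0 = 0" by (simp add: hess_field_def hom_ext_def vec_eq_iff)
  then have z: "z \<noteq> 0" using assms by auto
  have le: "norm (hess_field z) \<le> C * norm z powr \<beta> * t powr (\<beta> - 2 * (e - 1))"
    if t: "0 < t" "t < r / norm z" for t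
  proof -
    have "hess_field (t *\<^sub>R z) = t powr (2 * (e - 1)) *\<^sub>R hess_field z"
      using t by (simp add: vec_eq_iff hess_field_entry_scale)
    moreover have "norm (t *\<^sub>R z) < r" using t z by (simp add: pos_less_divide_eq)
    ultimately have "t powr (2 * (e - 1)) * norm (hess_field z) \<le> C * (t * norm z) powr \<beta>"
      using C[of "t *\<^sub>R z"] h0 t by simp
    also have "C * (t * norm z) powr \<beta> =
        t powr (2 * (e - 1)) * (C * norm z powr \<beta> * t powr (\<beta> - 2 * (e - 1)))"
      using t by (simp add: powr_mult flip: powr_add)
    finally show ?thesis
      using t by (simp only: mult_le_cancel_left_pos powr_gt_zero)
  qed
  have "((\<lambda>t. t powr (\<beta> - 2 * (e - 1))) \<longlongrightarrow> 0 powr (\<beta> - 2 * (e - 1))) (at_right (0::real))"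
    using assms(2) by (intro tendsto_powr' tendsto_ident_at tendsto_const) (auto simp: eventually_at_right_field intro: exI[of _ 1])
  then have "((\<lambda>t. C * norm z powr \<beta> * t powr (\<beta> - 2 * (e - 1))) \<longlongrightarrow> 0) (at_right (0::real))"
    by (intro tendsto_mult_right_zero) simp
  moreover have "\<forall>\<^sub>F t in at_right 0. norm (hess_field z) \<le> C * norm z powr \<beta> * t powr (\<beta> - 2 * (e - 1))"
    unfolding eventually_at_right_field using le Cr z by (intro exI[of _ "r / norm z"]) auto
  ultimately have "norm (hess_field z) \<le> 0"
    by (intro tendsto_lowerbound) auto
  then show False using assms by simp
qed

end

subsection \<open>Legendre functions of small degree\<close>

text \<open>The Taylor coefficients of the hypergeometric function 2F1(-a, a+1; 1; q).\<close>

fun legendre_coeff :: "real \<Rightarrow> nat \<Rightarrow> real" where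
  "legendre_coeff a 0 = 1"
| "legendre_coeff a (Suc n) = legendre_coeff a n * ((real n - a) * (real n + 1 + a)) / (real n + 1)\<^sup>2"

definition legendre_fps :: "real \<Rightarrow> real fps" where
  "legendre_fps a = Abs_fps (legendre_coeff a)"

text \<open>The \<open>k\<close>-th derivative of \<open>P\<^sub>a (1 - 2 q)\<close>, where \<open>P\<^sub>a\<close> is the Legendre function of degree \<open>a\<close>.\<close>

definition legendre :: "real \<Rightarrow> nat \<Rightarrow> real \<Rightarrow> real" where
  "legendre a k = eval_fps ((fps_deriv ^^ k) (legendre_fps a))"

text \<open>Comparing coefficients reduces the hypergeometric equation to the two-term recurrence of
  \<open>legendre_coeff\<close>.\<close>

lemma legendre_fps_ode:
  "fps_X * fps_deriv (fps_deriv (legendre_fps a)) - fps_X * (fps_X * fps_deriv (fps_deriv (legendre_fps a)))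
    + fps_deriv (legendre_fps a) - fps_const 2 * (fps_X * fps_deriv (legendre_fps a))
    + fps_const (a * (a + 1)) * legendre_fps a = 0"
proof (rule fps_ext)
  fix n
  let ?c = "legendre_coeff a"
  have rec: "?c (Suc m) * (real m + 1)\<^sup>2 = ?c m * ((real m - a) * (real m + 1 + a))" for m
    by (simp add: field_simps)
  have "fps_nth (fps_X * fps_deriv (fps_deriv (legendre_fps a))) n
      - fps_nth (fps_X * (fps_X * fps_deriv (fps_deriv (legendre_fps a)))) n
      + fps_nth (fps_deriv (legendre_fps a)) n - 2 * fps_nth (fps_X * fps_deriv (legendre_fps a)) n
      + fps_nth (fps_const (a * (a + 1)) * legendre_fps a) n = 0"
  proof (cases n)
    case 0
    then show ?thesis by (simp add: legendre_fps_def algebra_simps)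
  next
    case (Suc m)
    have "fps_nth (fps_X * (fps_X * fps_deriv (fps_deriv (legendre_fps a)))) n = real n * (real n - 1) * ?c n"
      using Suc by (cases m) (auto simp: legendre_fps_def algebra_simps)
    moreover have "fps_nth (fps_X * fps_deriv (fps_deriv (legendre_fps a))) n = (real n + 1) * real n * ?c (Suc n)"
      using Suc by (simp add: legendre_fps_def algebra_simps del: legendre_coeff.simps)
    moreover have "fps_nth (fps_deriv (legendre_fps a)) n = (real n + 1) * ?c (Suc n)"
      by (simp add: legendre_fps_def del: legendre_coeff.simps)
    moreover have "fps_nth (fps_X * fps_deriv (legendre_fps a)) n = real n * ?c n"
      using Suc by (simp add: legendre_fps_def del: legendre_coeff.simps)
    moreover have "fps_nth (fps_const (a * (a + 1)) * legendre_fps a) n = a * (a + 1) * ?c n"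
      by (simp add: legendre_fps_def)
    ultimately show ?thesis
      using rec[of n] by (simp add: algebra_simps power2_eq_square del: legendre_coeff.simps)
  qed
  then show "fps_nth (fps_X * fps_deriv (fps_deriv (legendre_fps a)) - fps_X * (fps_X * fps_deriv (fps_deriv (legendre_fps a)))
    + fps_deriv (legendre_fps a) - fps_const 2 * (fps_X * fps_deriv (legendre_fps a))
    + fps_const (a * (a + 1)) * legendre_fps a) n = fps_nth 0 n"
    by (simp del: fps_X_mult_nth fps_deriv_nth)
qed

context
  fixes a :: real
  assumes a: "0 < a" "a < 1 / 2"
begin

private abbreviation d :: "nat \<Rightarrow> real" where
  "d n \<equiv> - legendre_coeff a (Suc n)"

private definition K :: real where "K = a * (a + 1)"

section \<open>Sign and decay of the Legendre coefficients\<close>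

private lemma K_bounds: "0 < K" "K < 3 / 4"
proof -
  show "0 < K" using a by (simp add: K_def)
  have "a * (a + 1) < (1 / 2) * (1 / 2 + 1)"
    using a by (intro mult_strict_mono) auto
  then show "K < 3 / 4" by (simp add: K_def)
qed

text \<open>The factors \<open>(n + 1 - a) * (n + 2 + a)\<close> of the recurrence multiply out to
  \<open>(n + 1) * (n + 2) - K\<close>.\<close>

private lemma coeff_step:
  "(real n + 2) * d (Suc n) = (real n + 1) * d n * (1 - K / ((real n + 1) * (real n + 2)))"
  by (simp add: K_def power2_eq_square divide_simps) (simp add: algebra_simps)

text \<open>\<open>(n + 1) * d n\<close> starts at \<open>K\<close> and shrinks by the factors of
  \<open>coeff_step\<close>. Their total effect telescopes, as
  \<open>K / (n + 1) - K / (n + 2) = K / ((n + 1) * (n + 2))\<close>, so it stays above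
  \<open>K * (1 - K)\<close>.\<close>

private lemma legendre_coeff_bounds:
  "(real n + 1) * (- legendre_coeff a (Suc n)) \<in> {K * (1 - K + K / (real n + 1))..K}"
proof (induction n)
  case 0
  then show ?case by (simp add: K_def algebra_simps)
next
  case (Suc n)
  define f where "f = 1 - K / ((real n + 1) * (real n + 2))"
  define s where "s = 1 - K + K / (real n + 1)"
  have f: "0 \<le> f" "f \<le> 1"
  proof -
    have "K \<le> 1 * 1" using K_bounds by simp
    also have "\<dots> \<le> (real n + 1) * (real n + 2)" by (intro mult_mono) auto
    finally show "0 \<le> f" by (simp add: f_def)
    show "f \<le> 1" using K_bounds by (simp add: f_def)
  qed
  have "K / (real n + 1) \<le> K" using K_bounds by (simp add: field_simps)
  then have s: "s \<le> 1" "0 \<le> s" using K_bounds by (simp_all add: s_def)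
  have "1 - K + K / (real n + 2) = s - K / ((real n + 1) * (real n + 2))"
  proof -
    have "K / (real n + 1) - K / (real n + 2) = K / ((real n + 1) * (real n + 2))"
      by (simp add: divide_simps) (simp add: algebra_simps)
    then show ?thesis by (simp add: s_def)
  qed
  also have "\<dots> \<le> s - s * (K / ((real n + 1) * (real n + 2)))"
    using s K_bounds by (intro diff_left_mono mult_left_le_one_le) auto
  also have "\<dots> = s * f" by (simp add: f_def algebra_simps)
  finally have "K * (1 - K + K / (real n + 2)) \<le> K * s * f"
    using K_bounds by (simp add: mult.assoc)
  also have "\<dots> \<le> (real n + 1) * d n * f"
    using Suc f by (intro mult_right_mono) (auto simp: s_def)
  finally have lower: "K * (1 - K + K / (real n + 2)) \<le> (real n + 2) * d (Suc n)"
    unfolding coeff_step f_def .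
  have "(real n + 1) * d n * f \<le> K * 1"
    using Suc f K_bounds by (intro mult_mono) auto
  then have "(real n + 2) * d (Suc n) \<le> K"
    unfolding coeff_step f_def by simp
  then show ?case using lower by (simp add: add.commute del: legendre_coeff.simps)
qed

private lemma d_lower: "K * (1 - K) / (real n + 1) \<le> d n"
proof -
  have "0 \<le> K * (K / (real n + 1))" using K_bounds by simp
  then have "K * (1 - K) \<le> (real n + 1) * d n"
    using legendre_coeff_bounds[of n]
    unfolding atLeastAtMost_iff distrib_left[of K] by linarith
  then show ?thesis by (simp add: field_simps del: legendre_coeff.simps)
qed

private lemma d_pos: "0 < d n"
proof -
  have "0 < K * (1 - K) / (real n + 1)" using K_bounds by simp
  then show ?thesis using d_lower[of n] by linarith
qed

private lemma d_le: "d n \<le> 3 / 4"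
proof -
  have "1 * d n \<le> (real n + 1) * d n"
    using d_pos[of n] by (intro mult_right_mono) auto
  then show ?thesis
    using legendre_coeff_bounds[of n] K_bounds by (simp del: legendre_coeff.simps)
qed

private lemma abs_coeff_le: "\<bar>legendre_coeff a n\<bar> \<le> 1"
  using d_pos[of "n - 1"] d_le[of "n - 1"]
  by (cases n) (simp_all del: legendre_coeff.simps(2))

section \<open>Convergence on the unit disc and the Legendre equation\<close>

private lemma radius: "1 \<le> fps_conv_radius (legendre_fps a)"
  unfolding fps_conv_radius_def
proof (rule conv_radius_geI_ex')
  fix r :: real assume r: "0 < r" "ereal r < 1"
  show "summable (\<lambda>n. fps_nth (legendre_fps a) n * of_real r ^ n)"
  proof (rule summable_comparison_test')
    show "summable (\<lambda>n. r ^ n)" using r by (intro summable_geometric) auto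
    show "norm (fps_nth (legendre_fps a) n * of_real r ^ n) \<le> r ^ n" for n
      using abs_coeff_le[of n] r by (simp add: legendre_fps_def abs_mult mult_left_le_one_le)
  qed
qed

private lemma radius_deriv: "1 \<le> fps_conv_radius ((fps_deriv ^^ k) (legendre_fps a))"
  by (induction k) (auto intro: radius order_trans[OF _ fps_conv_radius_deriv])

private lemma less_radius_deriv:
  "\<bar>q\<bar> < 1 \<Longrightarrow> ereal (norm q) < fps_conv_radius ((fps_deriv ^^ k) (legendre_fps a))"
  for q :: real
  by (rule less_le_trans[OF _ radius_deriv]) auto

lemma legendre_deriv:
  "\<bar>q\<bar> < 1 \<Longrightarrow> (legendre a k has_field_derivative legendre a (Suc k) q) (at q)"
  unfolding legendre_def using has_field_derivative_eval_fps[OF less_radius_deriv] by simp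

lemma legendre_ode:
  assumes "\<bar>q\<bar> < 1"
  shows "q * (1 - q) * legendre a 2 q + (1 - 2 * q) * legendre a 1 q + a * (a + 1) * legendre a 0 q = 0"
proof -
  let ?R = "\<lambda>f. ereal \<bar>q\<bar> < fps_conv_radius f"
  have mult: "?R (f * g)" and add: "?R (f + g)" and diff: "?R (f - g)" if "?R f" "?R g" for f g :: "real fps"
    by (rule less_le_trans[OF _ fps_conv_radius_mult] less_le_trans[OF _ fps_conv_radius_add]
        less_le_trans[OF _ fps_conv_radius_diff]; use that in simp)+
  have "?R (legendre_fps a)" "?R (fps_deriv (legendre_fps a))" "?R (fps_deriv (fps_deriv (legendre_fps a)))"
    using less_radius_deriv[OF assms, of 0] less_radius_deriv[OF assms, of 1]
      less_radius_deriv[OF assms, of 2] by (simp_all add: numeral_2_eq_2)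
  then have "eval_fps (fps_X * fps_deriv (fps_deriv (legendre_fps a)) - fps_X * (fps_X * fps_deriv (fps_deriv (legendre_fps a)))
    + fps_deriv (legendre_fps a) - fps_const 2 * (fps_X * fps_deriv (legendre_fps a))
    + fps_const (a * (a + 1)) * legendre_fps a) q
    = q * legendre a 2 q - q * (q * legendre a 2 q) + legendre a 1 q - 2 * (q * legendre a 1 q)
      + a * (a + 1) * legendre a 0 q"
    by (simp add: eval_fps_add eval_fps_diff eval_fps_mult mult add diff legendre_def numeral_2_eq_2)
  then show ?thesis
    unfolding legendre_fps_ode by (simp add: algebra_simps)
qed

lemma legendre_at_0: "legendre a 0 0 = 1"
  by (simp add: legendre_def eval_fps_at_0 legendre_fps_def)

section \<open>A zero between 1/2 and 1\<close>

private lemma legendre_series: "\<bar>q\<bar> < 1 \<Longrightarrow> (\<lambda>n. d n * q ^ Suc n) sums (1 - legendre a 0 q)"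
proof -
  assume "\<bar>q\<bar> < 1"
  then have "(\<lambda>n. legendre_coeff a n * q ^ n) sums legendre a 0 q"
    using sums_eval_fps[OF less_radius_deriv[of q 0]] by (simp add: legendre_def legendre_fps_def)
  then have "(\<lambda>n. legendre_coeff a (Suc n) * q ^ Suc n) sums (legendre a 0 q - 1)"
    by (subst sums_Suc_iff) (simp del: legendre_coeff.simps(2))
  then show ?thesis
    using sums_minus by fastforce
qed

private lemma legendre_antimono:
  assumes "0 \<le> q" "q \<le> r" "r < 1"
  shows "legendre a 0 r \<le> legendre a 0 q"
proof -
  have "1 - legendre a 0 q \<le> 1 - legendre a 0 r"
  proof (rule sums_le[OF _ legendre_series legendre_series])
    show "d n * q ^ Suc n \<le> d n * r ^ Suc n" for n
      using assms d_pos[of n] by (intro mult_left_mono power_mono) auto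
  qed (use assms in auto)
  then show ?thesis by simp
qed

text \<open>A geometric series bounds the loss from the value 1 at the origin by 3/4. Positivity
  here pushes the zero beyond 1/2, which later gives \<open>\<nu> < 1\<close>.\<close>

private lemma legendre_half_pos: "0 < legendre a 0 (1 / 2)"
proof -
  have "1 - legendre a 0 (1 / 2) \<le> 3 / 4 * 1"
  proof (rule sums_le[OF _ legendre_series])
    show "(\<lambda>n. 3 / 4 * (1 / 2) ^ Suc n) sums (3 / 4 * (1::real))"
      by (intro sums_mult power_half_series)
    show "d n * (1 / 2) ^ Suc n \<le> 3 / 4 * (1 / 2) ^ Suc n" for n
      using d_le[of n] by (intro mult_right_mono) auto
  qed auto
  then show ?thesis by simp
qed

text \<open>All coefficients but the first are negative and of order \<open>1 / n\<close>, so the series diverges to minus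
  infinity at \<open>q = 1\<close>.\<close>

private lemma legendre_negative: "\<exists>q\<in>{0<..<1}. legendre a 0 q < 0"
proof (rule ccontr)
  assume "\<not> ?thesis"
  then have nonneg: "0 \<le> legendre a 0 q" if "q \<in> {0<..<1}" for q using that by (meson not_le)
  \<comment> \<open>Without a negative value, the partial sums of the positive series are at most 1
    for every \<open>q < 1\<close>, and letting \<open>q\<close> tend to 1 bounds those of
    \<open>d\<close>. But \<open>d\<close> dominates a multiple of the harmonic series.\<close>
  have "(\<Sum>n<N. d n) \<le> 1" for N
  proof -
    have "((\<lambda>q. \<Sum>n<N. d n * q ^ Suc n) \<longlongrightarrow> (\<Sum>n<N. d n * 1 ^ Suc n)) (at_left (1::real))"
      by (intro tendsto_intros)
    moreover have "\<forall>\<^sub>F q in at_left 1. (\<Sum>n<N. d n * q ^ Suc n) \<le> 1"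
    proof -
      have "(\<Sum>n<N. d n * q ^ Suc n) \<le> 1" if q: "0 < q" "q < 1" for q :: real
      proof -
        have series: "(\<lambda>n. d n * q ^ Suc n) sums (1 - legendre a 0 q)"
          using q by (intro legendre_series) auto
        have "(\<Sum>n<N. d n * q ^ Suc n) \<le> (\<Sum>n. d n * q ^ Suc n)"
        proof (rule sum_le_suminf)
          show "0 \<le> d n * q ^ Suc n" for n
            using d_pos[of n] q by (intro mult_nonneg_nonneg) (auto simp del: legendre_coeff.simps)
        qed (use series in \<open>auto simp: sums_iff\<close>)
        also have "\<dots> = 1 - legendre a 0 q"
          using series by (rule sums_unique[symmetric])
        finally have "(\<Sum>n<N. d n * q ^ Suc n) \<le> 1 - legendre a 0 q" .
        then show ?thesis using nonneg[of q] q by simp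
      qed
      then show ?thesis by (auto simp: eventually_at_left_field intro!: exI[of _ 0])
    qed
    ultimately show ?thesis
      by (auto dest: tendsto_upperbound simp del: legendre_coeff.simps)
  qed
  then have "summable d"
    by (rule summableI_nonneg_bounded[OF less_imp_le[OF d_pos]])
  then have "summable (\<lambda>n. K * (1 - K) / (real n + 1))"
    by (rule summable_comparison_test'[where N = 0])
      (use d_lower K_bounds in \<open>auto simp del: legendre_coeff.simps\<close>)
  then have "summable (\<lambda>n. K * (1 - K) * inverse (real (Suc n)))"
    by (simp add: divide_inverse add.commute)
  then have "summable (\<lambda>n. inverse (real (Suc n)))"
    using K_bounds by (simp add: summable_cmult_iff)
  then have "summable (\<lambda>n. inverse (real n))"
    by (subst (asm) summable_Suc_iff)
  then show False using not_summable_harmonic by blast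
qed

text \<open>The intermediate value theorem gives the zero, and monotonicity the sign before
  it.\<close>

lemma legendre_zero:
  obtains q0 where "1 / 2 < q0" "q0 < 1" "legendre a 0 q0 = 0" "\<And>q. q \<in> {0..q0} \<Longrightarrow> 0 \<le> legendre a 0 q"
proof -
  obtain b where b: "0 < b" "b < 1" "legendre a 0 b < 0" using legendre_negative by auto
  have hb: "1 / 2 < b"
    using legendre_antimono[of b "1 / 2"] legendre_half_pos b by (cases "b \<le> 1 / 2") auto
  have "\<exists>q0\<ge>1 / 2. q0 \<le> b \<and> legendre a 0 q0 = 0"
  proof (rule IVT2)
    show "\<forall>x. 1 / 2 \<le> x \<and> x \<le> b \<longrightarrow> isCont (legendre a 0) x"
      using b by (auto intro!: DERIV_isCont legendre_deriv)
  qed (use b hb legendre_half_pos in auto)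
  then obtain q0 where q0: "1 / 2 \<le> q0" "q0 \<le> b" "legendre a 0 q0 = 0" by blast
  show ?thesis
  proof
    show "1 / 2 < q0" using q0 legendre_half_pos by (cases "q0 = 1 / 2") auto
    show "q0 < 1" using q0 b by simp
    show "legendre a 0 q0 = 0" using q0 by simp
    show "0 \<le> legendre a 0 q" if "q \<in> {0..q0}" for q
      using legendre_antimono[of q q0] that q0 b by auto
  qed
qed

end

subsection \<open>Transmission across the interface\<close>

lemma has_field_derivative_glue:
  fixes f g :: "real \<Rightarrow> real"
  assumes f: "(f has_field_derivative D) (at x)" and g: "(g has_field_derivative D) (at x)"
    and eq: "f x = g x"
  shows "((\<lambda>t. if t \<le> x then f t else g t) has_field_derivative D) (at x)"
  unfolding has_field_derivative_iff
proof (rule filterlim_split_at)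
  have "((\<lambda>y. (f y - f x) / (y - x)) \<longlongrightarrow> D) (at_left x)"
    using f unfolding has_field_derivative_iff by (simp add: filterlim_at_split)
  then show "((\<lambda>y. ((if y \<le> x then f y else g y) - (if x \<le> x then f x else g x)) / (y - x)) \<longlongrightarrow> D) (at_left x)"
    by (rule Lim_transform_eventually) (auto simp: eventually_at_filter)
  have "((\<lambda>y. (g y - g x) / (y - x)) \<longlongrightarrow> D) (at_right x)"
    using g unfolding has_field_derivative_iff by (simp add: filterlim_at_split)
  then show "((\<lambda>y. ((if y \<le> x then f y else g y) - (if x \<le> x then f x else g x)) / (y - x)) \<longlongrightarrow> D) (at_right x)"
    by (rule Lim_transform_eventually) (auto simp: eventually_at_filter eq)
qed

text \<open>For \<open>u = |z|\<^bsup>2e\<^esup> f (t)\<close> with \<open>t = |y|\<^sup>2 / |z|\<^sup>2\<close> on \<open>\<real>\<^sup>2 \<times> \<real>\<^sup>2\<close>, the Laplacians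
  \<open>\<Delta>\<^sub>x u\<close> and \<open>\<Delta>\<^sub>y u\<close> are \<open>4 |z|\<^bsup>2e-2\<^esup>\<close> times \<open>lap_fst\<close> and \<open>lap_snd\<close>.\<close>

definition reflect_ext :: "real \<Rightarrow> (real \<Rightarrow> real) \<Rightarrow> real \<Rightarrow> real" where
  "reflect_ext c f t = (if t \<le> 1 / 2 then f t else c * f (1 - t))"

text \<open>For \<open>c = 1\<close> the matching conditions say that \<open>f'\<close> vanishes at
  1/2, for \<open>c = - 1\<close> that \<open>f\<close> does. Differentiation switches between even
  and odd reflection.\<close>

lemma reflect_ext_deriv:
  assumes f: "\<And>s. s \<in> {0..1 / 2} \<Longrightarrow> (f has_field_derivative f' s) (at s)"
    and eq: "f (1 / 2) = c * f (1 / 2)" "f' (1 / 2) = - c * f' (1 / 2)" and t: "t \<in> {0..1}"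
  shows "(reflect_ext c f has_field_derivative reflect_ext (- c) f' t) (at t)"
proof -
  have g: "((\<lambda>t. c * f (1 - t)) has_field_derivative - c * f' (1 - t)) (at t)" if "t \<in> {1 / 2..1}" for t
  proof -
    have "(f has_field_derivative f' (1 - t)) (at (1 - t))" using that by (intro f) auto
    then have "((\<lambda>t. f (1 - t)) has_field_derivative f' (1 - t) * (- 1)) (at t)"
      by (rule DERIV_chain2) (auto intro!: derivative_eq_intros)
    from DERIV_cmult[OF this, of c] show ?thesis by simp
  qed
  consider "t < 1 / 2" | "t = 1 / 2" | "1 / 2 < t" by linarith
  then show ?thesis
  proof cases
    case 1
    have "(f has_field_derivative f' t) (at t)" using 1 t by (intro f) auto
    then have "(reflect_ext c f has_field_derivative f' t) (at t)"
      by (rule has_field_derivative_transform_within_open[where S = "{..<1 / 2}"])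
        (use 1 in \<open>auto simp: reflect_ext_def\<close>)
    then show ?thesis using 1 by (simp add: reflect_ext_def)
  next
    case 2
    have "((\<lambda>t. c * f (1 - t)) has_field_derivative f' (1 / 2)) (at (1 / 2))"
      using g[of "1 / 2"] eq by simp
    then have "((\<lambda>t. if t \<le> 1 / 2 then f t else c * f (1 - t)) has_field_derivative f' (1 / 2)) (at (1 / 2))"
      by (intro has_field_derivative_glue f) (use eq in auto)
    then show ?thesis unfolding 2 reflect_ext_def[abs_def] by simp
  next
    case 3
    have "((\<lambda>t. c * f (1 - t)) has_field_derivative - c * f' (1 - t)) (at t)" using 3 t by (intro g) auto
    then have "(reflect_ext c f has_field_derivative - c * f' (1 - t)) (at t)"
      by (rule has_field_derivative_transform_within_open[where S = "{1 / 2<..}"])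
        (use 3 in \<open>auto simp: reflect_ext_def\<close>)
    then show ?thesis using 3 by (simp add: reflect_ext_def)
  qed
qed

text \<open>Even reflection is composition with the 1-Lipschitz map
  \<open>min t (1 - t)\<close>.\<close>

lemma lipschitz_reflect_ext:
  assumes "\<exists>L. L-lipschitz_on {0..1 / 2} f"
  shows "\<exists>L. L-lipschitz_on {0..1} (reflect_ext 1 f)"
proof -
  have "1-lipschitz_on {0..1} (\<lambda>t::real. min t (1 - t))"
    by (rule lipschitz_onI) (auto simp: dist_real_def min_def)
  then have "\<exists>L. L-lipschitz_on {0..1} (\<lambda>t. f (min t (1 - t)))"
    by (intro lipschitz_on_ex_compose[OF assms]) (auto simp: min_def)
  moreover have "reflect_ext 1 f = (\<lambda>t. f (min t (1 - t)))"
    by (auto simp: reflect_ext_def min_def fun_eq_iff intro: arg_cong[of _ _ f])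
  ultimately show ?thesis by simp
qed

definition lap_snd :: "real \<Rightarrow> real \<Rightarrow> real \<Rightarrow> real \<Rightarrow> real \<Rightarrow> real" where
  "lap_snd e t f f' f'' = (e * f + (1 - t) * f') +
     t * ((e - 1) * (e * f + (1 - t) * f') + (1 - t) * ((e - 1) * f' + (1 - t) * f''))"

definition lap_fst :: "real \<Rightarrow> real \<Rightarrow> real \<Rightarrow> real \<Rightarrow> real \<Rightarrow> real" where
  "lap_fst e t f f' f'' = (e * f - t * f') +
     (1 - t) * ((e - 1) * (e * f - t * f') - t * ((e - 1) * f' - t * f''))"

text \<open>Exchanging \<open>x\<close> and \<open>y\<close> replaces \<open>t\<close> by
  \<open>1 - t\<close>, which flips the sign of the first derivative.\<close>

lemma lap_reflect:
  "lap_fst e t f f' f'' = lap_snd e (1 - t) f (- f') f''"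
  "lap_snd e t f f' f'' = lap_fst e (1 - t) f (- f') f''"
  by (simp_all add: lap_fst_def lap_snd_def algebra_simps)

text \<open>Up to the factor \<open>m powr (e - 2)\<close>, the profile and its derivatives are
  \<open>m * m * P\<close>, \<open>m * A\<close> and \<open>B\<close>. Multiplying \<open>A\<close>
  by \<open>1 - t\<close> and \<open>B\<close> by its square eliminates \<nu> (\<open>c1\<close>,
  \<open>c2\<close>) and leaves polynomial identities modulo the Legendre equation. The two values
  express that \<open>lap_fst\<close> plus \<nu> times \<open>lap_snd\<close> is zero.\<close>

lemma lap_snd_profile:
  fixes P P1 P2 :: real
  assumes t: "t = s * m" and m: "m = \<nu> + (1 - \<nu>) * t" and "m \<noteq> 0" "t \<noteq> 1"
    and ode: "s * (1 - s) * P2 + (1 - 2 * s) * P1 + e * (e + 1) * P = 0"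
    and A: "A = (1 - \<nu>) * e * P + (1 - (1 - \<nu>) * s) * P1"
    and B: "B = (1 - \<nu>) * (e - 1) * A +
       (1 - (1 - \<nu>) * s) * ((1 - \<nu>) * e * P1 - (1 - \<nu>) * P1 + (1 - (1 - \<nu>) * s) * P2)"
  defines "w \<equiv> e * (e * (1 - 2 * s) * P - 2 * s * (1 - s) * P1)"
  shows "lap_snd e t (m * m * P) (m * A) B = - m * w"
    and "lap_fst e t (m * m * P) (m * A) B = \<nu> * m * w"
proof -
  have c1: "(1 - t) * (1 - \<nu>) = 1 - m" using m by (simp add: algebra_simps)
  have "m * ((1 - t) * (1 - (1 - \<nu>) * s)) = m * (1 - s)"
    using m t by algebra
  then have c2: "(1 - t) * (1 - (1 - \<nu>) * s) = 1 - s"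
    using \<open>m \<noteq> 0\<close> by simp
  define A1 where "A1 = (1 - m) * e * P + (1 - s) * P1"
  define B1 where "B1 = (1 - m) * (e - 1) * A1 + (1 - s) * ((1 - m) * (e - 1) * P1 + (1 - s) * P2)"
  have A1: "(1 - t) * A = A1"
    unfolding A A1_def using c1 c2 by algebra
  have B1: "(1 - t) * ((1 - t) * B) = B1"
    unfolding B B1_def A1[symmetric] using c1 c2 by algebra
  have "lap_snd e t (m * m * P) (m * A) B =
      (e * m * m * P + m * ((1 - t) * A)) + t * ((e - 1) * (e * m * m * P + m * ((1 - t) * A)) +
        (e - 1) * m * ((1 - t) * A) + (1 - t) * ((1 - t) * B))"
    by (simp add: lap_snd_def algebra_simps)
  also have "\<dots> = - m * w"
    unfolding A1 B1 A1_def B1_def w_def using ode t by algebra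
  finally show "lap_snd e t (m * m * P) (m * A) B = - m * w" .
  have c3: "\<nu> * (1 - t) = m * (1 - s)" using m t by (simp add: algebra_simps)
  \<comment> \<open>Unlike \<open>lap_snd\<close>, this expression lacks one factor
    \<open>1 - t\<close> for inserting \<open>A1\<close> and \<open>B1\<close>; it is supplied here
    and cancelled at the end.\<close>
  have "(1 - t) * lap_fst e t (m * m * P) (m * A) B =
      (1 - t) * e * m * m * P - t * m * ((1 - t) * A) +
      (1 - t) * ((e - 1) * ((1 - t) * e * m * m * P - t * m * ((1 - t) * A))
        - t * ((e - 1) * m * ((1 - t) * A))) + t * t * ((1 - t) * ((1 - t) * B))"
    by (simp add: lap_fst_def algebra_simps)
  also have "\<dots> = m * (1 - s) * m * w"
    unfolding A1 B1 A1_def B1_def w_def using ode t by algebra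
  also have "\<dots> = (1 - t) * (\<nu> * m * w)"
    using c3 by algebra
  finally show "lap_fst e t (m * m * P) (m * A) B = \<nu> * m * w"
    using \<open>t \<noteq> 1\<close> by simp
qed

text \<open>\<open>1 / (1 + \<nu>)\<close> is the value of the Legendre variable at the interface
  \<open>t = 1 / 2\<close>. Through \<open>zero\<close> both Laplacians vanish there, and
  \<open>nonneg\<close> fixes their signs inside the cone.\<close>

locale transmission =
  fixes e \<nu> :: real
  assumes e: "1 < e" "e < 3 / 2" and \<nu>: "0 < \<nu>" "\<nu> < 1"
    and zero: "legendre (e - 1) 0 (1 / (1 + \<nu>)) = 0"
    and nonneg: "q \<in> {0..1 / (1 + \<nu>)} \<Longrightarrow> 0 \<le> legendre (e - 1) 0 q"
begin

abbreviation p :: "nat \<Rightarrow> real \<Rightarrow> real" where "p \<equiv> legendre (e - 1)"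

text \<open>\<open>P\<close> is the Legendre function of degree \<open>e\<close>, expressed by the contiguous relation through the one of
  degree \<open>e - 1\<close>; this form gives the Laplacians of \<open>u\<close> in terms of \<open>p 0\<close>, whose sign is known.\<close>

definition P :: "real \<Rightarrow> real" where
  "P s = (1 - 2 * s) * p 0 s + 2 / e * (s * (1 - s)) * p 1 s"

text \<open>The derivative of \<open>P\<close>, with \<open>p 2\<close> eliminated by the Legendre
  equation, so that \<open>P2\<close> stops at second derivatives of \<open>p 0\<close>.\<close>

definition P1 :: "real \<Rightarrow> real" where
  "P1 s = (1 - 2 * s) * p 1 s - 2 * e * p 0 s"

definition P2 :: "real \<Rightarrow> real" where
  "P2 s = (1 - 2 * s) * p 2 s - (2 + 2 * e) * p 1 s"

section \<open>Relations between the Legendre functions of degrees \<open>e - 1\<close> and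
  \<open>e\<close>\<close>

lemma p_ode:
  assumes "\<bar>s\<bar> < 1"
  shows "s * (1 - s) * p 2 s + (1 - 2 * s) * p 1 s + (e - 1) * e * p 0 s = 0"
  using legendre_ode[of "e - 1" s] e assms by simp

lemma p_deriv: "\<bar>s\<bar> < 1 \<Longrightarrow> (p k has_field_derivative p (Suc k) s) (at s)"
  using legendre_deriv[of "e - 1" s k] e by simp

lemma P_deriv:
  assumes "\<bar>s\<bar> < 1"
  shows "(P has_field_derivative P1 s) (at s)" "(P1 has_field_derivative P2 s) (at s)"
proof -
  have d: "(p 0 has_field_derivative p 1 s) (at s)" "(p 1 has_field_derivative p 2 s) (at s)"
    using p_deriv[OF assms, of 0] p_deriv[OF assms, of 1] by (simp_all add: numeral_2_eq_2)
  have "(P has_field_derivative (1 - 2 * s) * p 1 s - 2 * p 0 s +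
      2 / e * (s * (1 - s) * p 2 s + (1 - 2 * s) * p 1 s)) (at s)"
  proof -
    define c where "c = 2 / e"
    show ?thesis
      unfolding P_def c_def[symmetric]
      by (auto intro!: derivative_eq_intros d simp: algebra_simps simp del: One_nat_def)
  qed
  moreover have "s * (1 - s) * p 2 s + (1 - 2 * s) * p 1 s = - (e - 1) * e * p 0 s"
    using p_ode[OF assms] by algebra
  then have "(1 - 2 * s) * p 1 s - 2 * p 0 s +
      2 / e * (s * (1 - s) * p 2 s + (1 - 2 * s) * p 1 s) = P1 s"
    unfolding P1_def using e by (simp only:) (simp add: field_simps)
  ultimately show "(P has_field_derivative P1 s) (at s)" by simp
  show "(P1 has_field_derivative P2 s) (at s)"
    unfolding P1_def P2_def
    by (auto intro!: derivative_eq_intros d simp: algebra_simps simp del: One_nat_def)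
qed

lemma P_ode:
  assumes "\<bar>s\<bar> < 1"
  shows "s * (1 - s) * P2 s + (1 - 2 * s) * P1 s + e * (e + 1) * P s = 0"
proof -
  have "e * P s = e * (1 - 2 * s) * p 0 s + 2 * (s * (1 - s)) * p 1 s"
    using e by (simp add: P_def field_simps)
  then show ?thesis
    unfolding P1_def P2_def using p_ode[OF assms] by algebra
qed

text \<open>The contiguous relation in the other direction; the left side is the \<open>w\<close> of
  \<open>lap_snd_profile\<close>.\<close>

lemma p_eq_P: "e * (e * (1 - 2 * s) * P s - 2 * s * (1 - s) * P1 s) = e\<^sup>2 * p 0 s"
proof -
  have "e * P s = e * (1 - 2 * s) * p 0 s + 2 * (s * (1 - s)) * p 1 s"
    using e by (simp add: P_def field_simps)
  then show ?thesis
    unfolding P1_def by algebra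
qed

text \<open>With \<open>t = |y|\<^sup>2 / |z|\<^sup>2\<close>, one has \<open>m t = (\<nu> |x|\<^sup>2 + |y|\<^sup>2) / |z|\<^sup>2\<close> and
  \<open>q t = |y|\<^sup>2 / (\<nu> |x|\<^sup>2 + |y|\<^sup>2)\<close>: the variables in which \<open>\<Delta>\<^sub>x + \<nu> \<Delta>\<^sub>y\<close> is a Laplacian.\<close>

definition m :: "real \<Rightarrow> real" where "m t = \<nu> + (1 - \<nu>) * t"

definition q :: "real \<Rightarrow> real" where "q t = t / m t"

text \<open>\<open>A\<close> and \<open>B\<close> result from differentiating
  \<open>m t powr e * P (q t)\<close> once and twice, with the power of \<open>m\<close> split
  off.\<close>

definition A :: "real \<Rightarrow> real" where
  "A s = (1 - \<nu>) * e * P s + (1 - (1 - \<nu>) * s) * P1 s"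

definition B :: "real \<Rightarrow> real" where
  "B s = (1 - \<nu>) * (e - 1) * A s +
     (1 - (1 - \<nu>) * s) * ((1 - \<nu>) * e * P1 s - (1 - \<nu>) * P1 s + (1 - (1 - \<nu>) * s) * P2 s)"

definition \<Psi> :: "real \<Rightarrow> real" where "\<Psi> t = m t powr e * P (q t)"
definition \<Psi>' :: "real \<Rightarrow> real" where "\<Psi>' t = m t powr (e - 1) * A (q t)"
definition \<Psi>'' :: "real \<Rightarrow> real" where "\<Psi>'' t = m t powr (e - 2) * B (q t)"

section \<open>The profile on the half interval\<close>

lemma m_pos: "0 \<le> t \<Longrightarrow> 0 < m t"
  unfolding m_def using \<nu> by (simp add: add_pos_nonneg)

lemma q_half: "q (1 / 2) = 1 / (1 + \<nu>)"
  unfolding q_def m_def using \<nu> by (simp add: field_simps)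

lemma q_bounds:
  assumes "t \<in> {0..1 / 2}"
  shows "q t \<in> {0..1 / (1 + \<nu>)}" "\<bar>q t\<bar> < 1"
proof -
  have "t * (1 + \<nu>) \<le> m t"
  proof -
    have "\<nu> * (2 * t) \<le> \<nu> * 1" using assms \<nu> by (intro mult_left_mono) auto
    then show ?thesis by (simp add: m_def algebra_simps)
  qed
  then show *: "q t \<in> {0..1 / (1 + \<nu>)}"
    using m_pos[of t] assms \<nu> by (auto simp: q_def field_simps)
  have "1 / (1 + \<nu>) < 1" using \<nu> by simp
  then show "\<bar>q t\<bar> < 1" using * by simp
qed

lemma q_deriv:
  assumes "0 \<le> t"
  shows "(q has_field_derivative \<nu> / (m t * m t)) (at t)"
proof -
  have "((\<lambda>t. t / m t) has_field_derivative (1 * m t - t * (1 - \<nu>)) / (m t * m t)) (at t)"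
    unfolding m_def
    by (intro DERIV_divide) (use m_pos[OF assms] in \<open>auto intro!: derivative_eq_intros simp: m_def\<close>)
  moreover have "1 * m t - t * (1 - \<nu>) = \<nu>" by (simp add: m_def algebra_simps)
  ultimately show ?thesis by (simp add: q_def[abs_def])
qed

text \<open>Because \<open>\<nu> / m t = 1 - (1 - \<nu>) * q t\<close>, the derivative is again a
  power of \<open>m\<close> times a function of \<open>q\<close>.\<close>

lemma powr_profile_deriv:
  assumes t: "0 \<le> t" and Q: "(Q has_field_derivative Q') (at (q t))"
  shows "((\<lambda>t. m t powr k * Q (q t)) has_field_derivative
    m t powr (k - 1) * ((1 - \<nu>) * k * Q (q t) + (1 - (1 - \<nu>) * q t) * Q')) (at t)"
proof -
  note mp = m_pos[OF t]
  have M: "((\<lambda>t. m t powr k) has_field_derivative k * m t powr (k - 1) * (1 - \<nu>)) (at t)"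
    unfolding m_def using mp
    by (auto intro!: derivative_eq_intros simp: m_def powr_diff field_simps)
  have "((\<lambda>t. m t powr k * Q (q t)) has_field_derivative
      m t powr k * (Q' * (\<nu> / (m t * m t))) + k * m t powr (k - 1) * (1 - \<nu>) * Q (q t)) (at t)"
    using DERIV_mult'[OF M DERIV_chain2[OF Q q_deriv[OF t]]] by (simp add: ac_simps)
  also have "m t powr k * (Q' * (\<nu> / (m t * m t))) = m t powr (k - 1) * (\<nu> / m t * Q')"
    using mp by (simp add: powr_diff)
  also have "\<nu> / m t = 1 - (1 - \<nu>) * q t"
    using mp by (simp add: q_def m_def field_simps)
  finally show ?thesis by (simp only: algebra_simps)
qed

lemma \<Psi>_deriv:
  assumes "t \<in> {0..1 / 2}"
  shows "(\<Psi> has_field_derivative \<Psi>' t) (at t)" "(\<Psi>' has_field_derivative \<Psi>'' t) (at t)"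
proof -
  note q1 = q_bounds(2)[OF assms]
  show "(\<Psi> has_field_derivative \<Psi>' t) (at t)"
    unfolding \<Psi>_def \<Psi>'_def A_def
    by (rule powr_profile_deriv) (use assms P_deriv[OF q1] in auto)
  have "(A has_field_derivative (1 - \<nu>) * e * P1 (q t) - (1 - \<nu>) * P1 (q t) + (1 - (1 - \<nu>) * q t) * P2 (q t)) (at (q t))"
    unfolding A_def by (auto intro!: derivative_eq_intros P_deriv q1 simp: algebra_simps)
  from powr_profile_deriv[OF _ this, of "e - 1"] show "(\<Psi>' has_field_derivative \<Psi>'' t) (at t)"
    unfolding \<Psi>'_def \<Psi>''_def B_def using assms by simp
qed

text \<open>At the interface \<open>p 0\<close> vanishes, so \<open>P\<close> and \<open>P1\<close>
  are multiples of \<open>p 1\<close>, and their contributions to \<open>A\<close> cancel for this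
  \<open>s\<close>. Both the even reflection of \<open>\<Psi>\<close> and the odd one of
  \<open>\<Psi>'\<close> rest on this single condition.\<close>

lemma \<Psi>'_half: "\<Psi>' (1 / 2) = 0"
proof -
  define s where "s = 1 / (1 + \<nu>)"
  have s: "s * (1 + \<nu>) = 1" using \<nu> by (simp add: s_def)
  have "e * P s = 2 * (s * (1 - s)) * p 1 s" "P1 s = (1 - 2 * s) * p 1 s"
    using e zero by (simp_all add: P_def P1_def s_def)
  then have "A s = 0"
    unfolding A_def using s by algebra
  then show ?thesis by (simp add: \<Psi>'_def q_half s_def)
qed

text \<open>On the half interval \<open>q\<close> stays below \<open>1 / (1 + \<nu>) < 1\<close>,
  away from the logarithmic singularity.\<close>

lemma lipschitz_\<Psi>'': "\<exists>L. L-lipschitz_on {0..1 / 2} \<Psi>''"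
proof -
  have "1 / (1 + \<nu>) < 1" using \<nu> by simp
  then have "\<exists>L. L-lipschitz_on {0..1 / (1 + \<nu>)} (p k)" for k
    by (intro lipschitz_on_ex_deriv[where f' = "p (Suc k)"] p_deriv continuous_at_imp_continuous_on ballI
        DERIV_isCont[OF p_deriv]) auto
  then have B: "\<exists>L. L-lipschitz_on {0..1 / (1 + \<nu>)} B"
    unfolding B_def A_def P_def P1_def P2_def
    by (intro lipschitz_on_ex_add lipschitz_on_ex_diff lipschitz_on_mult_compact lipschitz_on_ex_const
        lipschitz_on_ex_id compact_Icc)
  have m: "(m has_field_derivative 1 - \<nu>) (at t)" for t
    unfolding m_def by (auto intro!: derivative_eq_intros)
  have cm: "continuous_on {0..1 / 2} m"
    by (intro continuous_at_imp_continuous_on ballI DERIV_isCont[OF m])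
  have m0: "m t \<noteq> 0" if "t \<in> {0..1 / 2}" for t using m_pos[of t] that by auto
  have "\<exists>L. L-lipschitz_on {0..1 / 2} q"
    by (rule lipschitz_on_ex_deriv[where f' = "\<lambda>t. \<nu> / (m t * m t)"])
      (use m0 in \<open>auto intro!: q_deriv continuous_intros cm\<close>)
  then have Bq: "\<exists>L. L-lipschitz_on {0..1 / 2} (\<lambda>t. B (q t))"
    by (rule lipschitz_on_ex_compose[OF B]) (use q_bounds in auto)
  have "\<exists>L. L-lipschitz_on {0..1 / 2} (\<lambda>t. m t powr (e - 2))"
  proof (rule lipschitz_on_ex_deriv)
    show "((\<lambda>t. m t powr (e - 2)) has_field_derivative (e - 2) * m t powr (e - 2 - 1) * (1 - \<nu>)) (at t)"
      if "t \<in> {0..1 / 2}" for t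
      by (rule DERIV_chain2[OF has_real_derivative_powr m]) (use m_pos[of t] that in auto)
    show "continuous_on {0..1 / 2} (\<lambda>t. (e - 2) * m t powr (e - 2 - 1) * (1 - \<nu>))"
      by (intro continuous_intros cm) (use m0 in auto)
  qed
  then show ?thesis
    unfolding \<Psi>''_def by (intro lipschitz_on_mult_compact Bq compact_Icc)
qed

section \<open>Reflection across the interface\<close>

definition \<Phi> :: "real \<Rightarrow> real" where "\<Phi> = reflect_ext 1 \<Psi>"
definition \<Phi>' :: "real \<Rightarrow> real" where "\<Phi>' = reflect_ext (- 1) \<Psi>'"
definition \<Phi>'' :: "real \<Rightarrow> real" where "\<Phi>'' = reflect_ext 1 \<Psi>''"

lemma \<Phi>_deriv:
  assumes "t \<in> {0..1}"
  shows "(\<Phi> has_field_derivative \<Phi>' t) (at t)" "(\<Phi>' has_field_derivative \<Phi>'' t) (at t)"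
  using reflect_ext_deriv[of \<Psi> \<Psi>' 1 t] reflect_ext_deriv[of \<Psi>' \<Psi>'' "- 1" t] \<Psi>_deriv \<Psi>'_half assms
  by (simp_all add: \<Phi>_def \<Phi>'_def \<Phi>''_def)

lemma lap_\<Psi>:
  assumes "t \<in> {0..1 / 2}"
  obtains c where "0 \<le> c" "lap_fst e t (\<Psi> t) (\<Psi>' t) (\<Psi>'' t) = \<nu> * c"
    "lap_snd e t (\<Psi> t) (\<Psi>' t) (\<Psi>'' t) = - c"
proof -
  define g where "g = m t powr (e - 2)"
  define s where "s = q t"
  have mp: "0 < m t" using m_pos assms by simp
  have pow: "m t powr e = g * (m t * m t)" "m t powr (e - 1) = g * m t"
    using mp by (simp_all add: g_def powr_diff power2_eq_square)
  have \<Psi>: "\<Psi> t = g * (m t * m t * P s)" "\<Psi>' t = g * (m t * A s)" "\<Psi>'' t = g * B s"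
    by (simp_all add: \<Psi>_def \<Psi>'_def \<Psi>''_def pow g_def s_def)
  have ts: "t = s * m t" using mp by (simp add: s_def q_def)
  have s1: "\<bar>s\<bar> < 1" using q_bounds assms by (simp add: s_def)
  note lap = lap_snd_profile[OF ts m_def _ _ P_ode[OF s1] A_def B_def, unfolded p_eq_P]
  have scale: "lap_fst e t (g * x) (g * y) (g * z) = g * lap_fst e t x y z"
    "lap_snd e t (g * x) (g * y) (g * z) = g * lap_snd e t x y z" for x y z
    by (simp_all add: lap_fst_def lap_snd_def algebra_simps)
  show ?thesis
  proof
    show "0 \<le> g * (m t * (e\<^sup>2 * p 0 s))"
      using mp nonneg[of s] q_bounds[OF assms] by (simp add: g_def s_def)
    show "lap_fst e t (\<Psi> t) (\<Psi>' t) (\<Psi>'' t) = \<nu> * (g * (m t * (e\<^sup>2 * p 0 s)))"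
      "lap_snd e t (\<Psi> t) (\<Psi>' t) (\<Psi>'' t) = - (g * (m t * (e\<^sup>2 * p 0 s)))"
      unfolding \<Psi> scale using lap mp assms by simp_all
  qed
qed

text \<open>For \<open>t \<le> 1 / 2\<close> the first operator vanishes and the second is
  \<open>(\<nu> * \<nu> - 1) * c \<le> 0\<close>; beyond, \<open>lap_reflect\<close> exchanges their
  roles.\<close>

lemma max_lap_\<Phi>:
  assumes "t \<in> {0..1}"
  defines "X \<equiv> lap_fst e t (\<Phi> t) (\<Phi>' t) (\<Phi>'' t)" and "Y \<equiv> lap_snd e t (\<Phi> t) (\<Phi>' t) (\<Phi>'' t)"
  shows "max (X + \<nu> * Y) (\<nu> * X + Y) = 0"
proof -
  have neg: "\<nu> * (\<nu> * c) - c \<le> 0" if "0 \<le> c" for c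
  proof -
    have "\<nu> * \<nu> * c \<le> 1 * c" using \<nu> that by (intro mult_right_mono mult_le_one) auto
    then show ?thesis by simp
  qed
  show ?thesis
  proof (cases "t \<le> 1 / 2")
    case True
    then obtain c where c: "0 \<le> c" "X = \<nu> * c" "Y = - c"
      using lap_\<Psi>[of t] assms(1) unfolding X_def Y_def \<Phi>_def \<Phi>'_def \<Phi>''_def
      by (auto simp: reflect_ext_def)
    then show ?thesis using neg[of c] by simp
  next
    case False
    then obtain c where c: "0 \<le> c" "Y = \<nu> * c" "X = - c"
      using lap_\<Psi>[of "1 - t"] assms(1) unfolding X_def Y_def \<Phi>_def \<Phi>'_def \<Phi>''_def
      by (auto simp: reflect_ext_def lap_reflect[of e t])
    then show ?thesis using neg[of c] by (simp add: add.commute)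
  qed
qed

lemma \<Phi>_0_pos: "0 < \<Phi> 0"
proof -
  have "legendre (e - 1) 0 0 = 1" using legendre_at_0 e by simp
  then show ?thesis
    using \<nu> by (simp add: \<Phi>_def reflect_ext_def \<Psi>_def q_def P_def m_def)
qed

end

text \<open>Solving \<open>1 / (1 + \<nu>) = q0\<close> for the zero \<open>q0\<close> gives \<nu>,
  and \<open>q0 > 1 / 2\<close> makes it less than 1.\<close>

lemma transmission_exists:
  assumes "1 < e" "e < 3 / 2"
  obtains \<nu> where "transmission e \<nu>"
proof -
  obtain q0 where q0: "1 / 2 < q0" "q0 < 1" "legendre (e - 1) 0 q0 = 0"
    "\<And>q. q \<in> {0..q0} \<Longrightarrow> 0 \<le> legendre (e - 1) 0 q"
    using legendre_zero[of "e - 1"] assms by auto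
  have "1 / (1 + (1 - q0) / q0) = q0" using q0 by (simp add: field_simps)
  then have "transmission e ((1 - q0) / q0)"
    using assms q0 by unfold_locales (auto simp: field_simps)
  then show ?thesis using that by blast
qed

subsection \<open>Diagonal operators and the counterexample\<close>

definition diag_matrix :: "('n \<Rightarrow> real) \<Rightarrow> real^'n^'n" where
  "diag_matrix d = (\<chi> i j. if i = j then d i else 0)"

lemma symmetric_diag_matrix: "symmetric_matrix (diag_matrix d)"
  by (simp add: symmetric_matrix_def diag_matrix_def transpose_def vec_eq_iff)

lemma diag_matrix_quadratic: "x \<bullet> (diag_matrix d *v x) = (\<Sum>i\<in>UNIV. d i * (x $ i)\<^sup>2)"
proof -
  have "(diag_matrix d *v x) $ i = d i * x $ i" for i
    by (simp add: diag_matrix_def matrix_vector_mult_def if_distrib[of "\<lambda>y. y * _"] cong: if_cong)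
  then show ?thesis
    by (simp add: inner_vec_def power2_eq_square ac_simps)
qed

lemma uniformly_elliptic_diag_matrix:
  fixes d :: "'n::finite \<Rightarrow> real"
  assumes "0 < l" "l \<le> L" "\<And>i. l \<le> d i \<and> d i \<le> L"
  shows "uniformly_elliptic (diag_matrix d)"
proof -
  have "c *\<^sub>R mat 1 = (diag_matrix (\<lambda>i. c) :: real^'n^'n)" for c
    by (simp add: diag_matrix_def mat_def vec_eq_iff)
  then show ?thesis
    unfolding uniformly_elliptic_def loewner_le_def
    using assms by (intro exI[of _ l] exI[of _ L])
      (auto simp: diag_matrix_quadratic intro!: sum_mono mult_right_mono)
qed

lemma trace_diag_matrix_mult: "trace (diag_matrix d ** H) = (\<Sum>i\<in>UNIV. d i * H $ i $ i)"
  by (simp add: trace_def matrix_matrix_mult_def diag_matrix_def if_distrib[of "\<lambda>y. y * _"] cong: if_cong)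

theorem theorem1p1:
  fixes \<sigma> :: real
  assumes "0 < \<sigma>" and "\<sigma> < 1"
  shows "\<exists>(A\<^sub>1 :: real^4^4) (A\<^sub>2 :: real^4^4) (u :: real^4 \<Rightarrow> real).
           symmetric_matrix A\<^sub>1 \<and> symmetric_matrix A\<^sub>2 \<and>
           uniformly_elliptic A\<^sub>1 \<and> uniformly_elliptic A\<^sub>2 \<and>
           u \<noteq> (\<lambda>z. 0) \<and> C2_holder_loc \<sigma> u \<and> homogeneous (2 + \<sigma>) u \<and>
           (\<forall>z. max (trace (A\<^sub>1 ** hessian u z)) (trace (A\<^sub>2 ** hessian u z)) = 0) \<and>
           (\<forall>\<beta>>\<sigma>. \<not> C2_holder_at_origin \<beta> u)"
proof -
  define e where "e = 1 + \<sigma> / 2"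
  have e_bounds: "1 < e" "e < 3 / 2" and degree: "2 * (e - 1) = \<sigma>" "2 * e = 2 + \<sigma>"
    using assms by (simp_all add: e_def)
  obtain \<nu> where "transmission e \<nu>"
    using transmission_exists e_bounds by blast
  then interpret transmission e \<nu> .
  \<comment> \<open>The indicator of the \<open>y\<close> coordinates, so that
    \<open>weight_ratio\<close> is |y|^2 / |z|^2. In the index type \<open>4\<close> the numeral 4
    denotes 0, so 1 to 4 are all the indices.\<close>
  define \<kappa> :: "4 \<Rightarrow> real" where "\<kappa> i = (if i = 3 \<or> i = 4 then 1 else 0)" for i
  interpret H: homogeneous_profile \<kappa> e \<Phi> \<Phi>' \<Phi>''
    by unfold_locales (use e \<Phi>_deriv lipschitz_reflect_ext[OF lipschitz_\<Psi>''] in \<open>auto simp: \<kappa>_def \<Phi>''_def\<close>)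
  have \<kappa>: "\<kappa> 1 = 0" "\<kappa> 2 = 0" "\<kappa> 3 = 1" "\<kappa> 4 = 1" by (simp_all add: \<kappa>_def)
  define A\<^sub>1 where "A\<^sub>1 = diag_matrix (\<lambda>i. 1 - \<kappa> i + \<nu> * \<kappa> i)"
  define A\<^sub>2 where "A\<^sub>2 = diag_matrix (\<lambda>i. \<nu> * (1 - \<kappa> i) + \<kappa> i)"
  have ell: "uniformly_elliptic A\<^sub>1" "uniformly_elliptic A\<^sub>2"
    unfolding A\<^sub>1_def A\<^sub>2_def using \<nu>
    by (auto intro!: uniformly_elliptic_diag_matrix[of \<nu> 1] simp: \<kappa>_def)
  have pde: "max (trace (A\<^sub>1 ** H.hess_field z)) (trace (A\<^sub>2 ** H.hess_field z)) = 0" for z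
  proof (cases "z = 0")
    case True
    then show ?thesis
      by (simp add: A\<^sub>1_def A\<^sub>2_def trace_diag_matrix_mult H.hess_field_def hom_ext_def)
  next
    case False
    define t where "t = weight_ratio \<kappa> z"
    define \<rho> where "\<rho> = z \<bullet> z"
    define r where "r = \<rho> powr (e - 2)"
    define X where "X = lap_fst e t (\<Phi> t) (\<Phi>' t) (\<Phi>'' t)"
    define Y where "Y = lap_snd e t (\<Phi> t) (\<Phi>' t) (\<Phi>'' t)"
    have \<rho>: "0 < \<rho>" using False by (simp add: \<rho>_def)
    have r: "\<rho> powr (e - 1) = r * \<rho>" using \<rho> by (simp add: r_def powr_diff power2_eq_square)
    have snd: "(z $ 3)\<^sup>2 + (z $ 4)\<^sup>2 = t * \<rho>"
      using \<rho> by (simp add: t_def weight_ratio_def weighted_form_def sum_4 \<kappa> \<rho>_def)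
    have "\<rho> = (z $ 1)\<^sup>2 + (z $ 2)\<^sup>2 + (z $ 3)\<^sup>2 + (z $ 4)\<^sup>2"
      by (simp add: \<rho>_def inner_vec_def sum_4 power2_eq_square)
    then have fst: "(z $ 1)\<^sup>2 + (z $ 2)\<^sup>2 = (1 - t) * \<rho>"
      using snd by (simp add: algebra_simps)
    have entry: "H.hess_field z $ i $ i = r * (2 * \<rho> * H.grad_profile i t + 4 * (z $ i)\<^sup>2 * H.hess_profile i i t)" for i
      using r by (simp add: H.hess_field_def hom_ext_def t_def[symmetric] \<rho>_def[symmetric] r_def[symmetric]
          power2_eq_square algebra_simps)
    have prof: "H.grad_profile i t = H.grad_profile j t" "H.hess_profile i i t = H.hess_profile j j t"
      if "\<kappa> i = \<kappa> j" for i j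
      using that by (simp_all add: H.grad_profile_def[abs_def] H.grad_profile'_def[abs_def] H.hess_profile_def)
    \<comment> \<open>Since \<kappa> is constant on the \<open>x\<close> block, its two diagonal
      entries share their profiles, and the squares of the coordinates add up to
      \<open>(1 - t) * \<rho>\<close>.\<close>
    have "H.hess_field z $ 1 $ 1 + H.hess_field z $ 2 $ 2 =
        r * (4 * \<rho> * H.grad_profile 1 t + 4 * ((z $ 1)\<^sup>2 + (z $ 2)\<^sup>2) * H.hess_profile 1 1 t)"
      unfolding entry using prof[of 2 1] \<kappa> by (simp add: algebra_simps)
    also have "\<dots> = 4 * r * \<rho> * X"
      unfolding fst X_def lap_fst_def H.hess_profile_def H.grad_profile_def H.grad_profile'_def hom_partial_def \<kappa>
      by (simp add: algebra_simps)
    finally have fst': "H.hess_field z $ 1 $ 1 + H.hess_field z $ 2 $ 2 = 4 * r * \<rho> * X" .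
    have "H.hess_field z $ 3 $ 3 + H.hess_field z $ 4 $ 4 =
        r * (4 * \<rho> * H.grad_profile 3 t + 4 * ((z $ 3)\<^sup>2 + (z $ 4)\<^sup>2) * H.hess_profile 3 3 t)"
      unfolding entry using prof[of 4 3] \<kappa> by (simp add: algebra_simps)
    also have "\<dots> = 4 * r * \<rho> * Y"
      unfolding snd Y_def lap_snd_def H.hess_profile_def H.grad_profile_def H.grad_profile'_def hom_partial_def \<kappa>
      by (simp add: algebra_simps)
    finally have snd': "H.hess_field z $ 3 $ 3 + H.hess_field z $ 4 $ 4 = 4 * r * \<rho> * Y" .
    have tr: "trace (A\<^sub>1 ** H.hess_field z) = 4 * r * \<rho> * (X + \<nu> * Y)"
      "trace (A\<^sub>2 ** H.hess_field z) = 4 * r * \<rho> * (\<nu> * X + Y)"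
      unfolding A\<^sub>1_def A\<^sub>2_def trace_diag_matrix_mult sum_4 \<kappa> using fst' snd'
      by (simp_all, algebra+)
    have "0 \<le> 4 * r * \<rho>" using \<rho> by (simp add: r_def)
    then have "max (4 * r * \<rho> * (X + \<nu> * Y)) (4 * r * \<rho> * (\<nu> * X + Y)) = 4 * r * \<rho> * max (X + \<nu> * Y) (\<nu> * X + Y)"
      by (simp add: max_mult_distrib_left)
    also have "max (X + \<nu> * Y) (\<nu> * X + Y) = 0"
      unfolding X_def Y_def by (rule max_lap_\<Phi>) (unfold t_def, rule H.ratio)
    finally show ?thesis unfolding tr by simp
  qed
  \<comment> \<open>A unit vector in the plane \<open>y = 0\<close>: there
    \<open>t = \<kappa> 1 = 0\<close> removes all derivative terms of the profile, leaving positive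
    multiples of \<open>\<Phi> 0\<close> in \<open>u\<close> and in its first Hessian entry.\<close>
  have ax: "weight_ratio \<kappa> (axis 1 1) = 0" "(axis 1 1 :: real^4) \<bullet> axis 1 1 = 1"
    by (simp_all add: weight_ratio_def weighted_form_def sum_4 \<kappa> axis_def inner_vec_def)
  have "H.u (axis 1 1) \<noteq> 0"
    using \<Phi>_0_pos by (simp add: hom_ext_def ax)
  then have u: "H.u \<noteq> (\<lambda>z. 0)" by metis
  have "H.hess_field (axis 1 1) $ 1 $ 1 = 2 * (e * \<Phi> 0) + 4 * ((e - 1) * (e * \<Phi> 0))"
    by (simp add: H.hess_field_def hom_ext_def ax H.grad_profile_def H.hess_profile_def hom_partial_def \<kappa>)
  also have "\<dots> > 0" using e \<Phi>_0_pos by (intro add_pos_pos mult_pos_pos) auto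
  finally have "H.hess_field (axis 1 1) \<noteq> 0" by auto
  then have "\<not> C2_holder_at_origin \<beta> H.u" if "\<sigma> < \<beta>" for \<beta>
    using H.not_C2_holder_at_origin_u[unfolded degree] that by blast
  moreover have "symmetric_matrix A\<^sub>1" "symmetric_matrix A\<^sub>2"
    by (simp_all add: A\<^sub>1_def A\<^sub>2_def symmetric_diag_matrix)
  ultimately show ?thesis
    using ell u H.C2_holder_loc_u[unfolded degree] H.homogeneous_u[unfolded degree] pde[folded H.hessian_u]
    by blast
qed

end
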